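(* Let $a\ge 2$ be an integer. Then for $z\in\mathbb{C}$ with $z\neq 0$ and $|q|<1$ we have $$\sum_{\substack{\vec n=(n_0,n_1,\dots,n_{a-1})\in\mathbb{Z}^a\\ \vec n\cdot\vec 1_a=0}} q^{\frac{a}{2}\vec n\cdot\vec n+\vec b_a\cdot\vec n}\left(z^{an_1+1}+z^{an_2+2}+\cdots+z^{an_{a-1}+a-1}+z^{-an_{a-1}}\right)$$ $$= E(q)\,E(q^a)^{a-2}\prod_{n=1}^\infty\frac{(1-z^aq^{a(n-1)})(1-z^{-a}q^{an})}{(1-zq^{n-1})(1-z^{-1}q^n)}.$$
   Context: Throughout, $q=\exp(2\pi i\tau)$ with $\operatorname{Im}\tau>0$ (so $0<|q|<1$). $E(q):=\prod_{n=1}^\infty(1-q^n)$. $\vec 1_a=(1,1,\dots,1)\in\mathbb{Z}^a$, $\vec b_a=(0,1,2,\dots,a-1)\in\mathbb{Z}^a$, and $\cdot$ is the standard dot product. The bracketed factor in the sum has $a$ terms: $z^{an_j+j}$ for $1\le j\le a-1$, together with $z^{-an_{a-1}}$. When $z$ is an integer power of $q$, a denominator factor vanishes; each quotient $\frac{1-w^a}{1-w}$ (with $w=zq^{n-1}$ or $w=z^{-1}q^n$) is then understood by its removable-singularity value $1+w+\cdots+w^{a-1}$. *)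

theory Defs
  imports "HOL-Analysis.Analysis"
begin

definition E :: "complex \<Rightarrow> complex" where
  "E q = (\<Prod>n. 1 - q ^ Suc n)"

(* Vectors in Z^a are functions nat => int read on {..<a}. *)
definition dotp :: "nat \<Rightarrow> (nat \<Rightarrow> int) \<Rightarrow> (nat \<Rightarrow> int) \<Rightarrow> int" where
  "dotp a x y = (\<Sum>i<a. x i * y i)"

definition ones :: "nat \<Rightarrow> int" where
  "ones = (\<lambda>_. 1)"

definition bvec :: "nat \<Rightarrow> int" where
  "bvec = (\<lambda>j. int j)"

(* Using the extensional function space makes each vector of Z^a occur exactly once. *)
definition zero_sum_vecs :: "nat \<Rightarrow> (nat \<Rightarrow> int) set" where
  "zero_sum_vecs a = {n \<in> {..<a} \<rightarrow>\<^sub>E UNIV. dotp a n ones = 0}"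

(* The division by 2 is exact on zero_sum_vecs a, see dotp_self_even. *)
definition qexponent :: "nat \<Rightarrow> (nat \<Rightarrow> int) \<Rightarrow> int" where
  "qexponent a n = (int a * dotp a n n) div 2 + dotp a bvec n"

definition summand :: "nat \<Rightarrow> complex \<Rightarrow> complex \<Rightarrow> (nat \<Rightarrow> int) \<Rightarrow> complex" where
  "summand a q z n = q powi qexponent a n *
     ((\<Sum>j = 1..a - 1. z powi (int a * n j + int j)) + z powi (- (int a * n (a - 1))))"

(* (1 - w^a) / (1 - w), with the removable singularity at w = 1 filled in;
   without the case distinction HOL's x / 0 = 0 would give the wrong value there. *)
definition geom_quot :: "nat \<Rightarrow> complex \<Rightarrow> complex" where
  "geom_quot a w = (if w = 1 then (\<Sum>k<a. w ^ k) else (1 - w ^ a) / (1 - w))"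

definition prod_factor :: "nat \<Rightarrow> complex \<Rightarrow> complex \<Rightarrow> nat \<Rightarrow> complex" where
  "prod_factor a q z n = geom_quot a (z * q ^ (n - 1)) * geom_quot a (inverse z * q ^ n)"

lemma dotp_self_even:
  assumes "n \<in> zero_sum_vecs a"
  shows "even (dotp a n n)"
proof -
  have "even (\<Sum>i<a. n i * n i - n i)"
    by (intro dvd_sum) auto
  moreover have "(\<Sum>i<a. n i) = 0"
    using assms by (simp add: zero_sum_vecs_def dotp_def ones_def)
  ultimately show ?thesis
    by (simp add: dotp_def sum_subtractf)
qed

lemma convergent_prod_E:
  fixes q :: complex
  assumes "norm q < 1"
  shows "convergent_prod (\<lambda>n. 1 - q ^ Suc n)"
proof -
  have "summable (\<lambda>n. norm (1 - q ^ Suc n - 1))"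
    using assms by (simp add: norm_mult norm_power summable_mult)
  then show ?thesis
    using abs_convergent_prod_conv_summable abs_convergent_prod_imp_convergent_prod by blast
qed

end

theory Submission
  imports Defs
begin

text \<open>
  Write \<open>theta q z\<close> for the series \<open>\<Sum>\<^sub>\<infinity>k. q powi (k (k - 1) / 2) * z powi k\<close> over the integers.
  The bracket on the left-hand side is made uniform first: reversing and negating a vector maps
  \<open>z powi (- a n\<^bsub>a-1\<^esub>)\<close> to \<open>z powi (a n\<^sub>0)\<close> and keeps the power of \<open>q\<close>, so the left-hand side
  is the function \<open>L z = crank_sum a q z\<close> in which \<open>j\<close> runs through all residues \<open>0, \<dots>, a - 1\<close>.
  A vector \<open>n\<close> is thought of as the configuration of the \<open>a\<close> beads \<open>a n\<^sub>j + j\<close>, one in each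
  residue class modulo \<open>a\<close>; then \<open>L\<close> marks one bead at a time.

  Two facts determine \<open>L\<close> up to a constant. Moving the marked bead from \<open>k\<close> to \<open>k + a - 1\<close> and all
  the others down by one preserves the sum of the beads, keeps one bead in each residue class, and
  multiplies the power of \<open>q\<close> by \<open>q powi k\<close>; so the Laurent coefficients of \<open>L\<close> satisfy
  \<open>c\<^bsub>k+a-1\<^esub> = q powi k * c\<^sub>k\<close> (\<open>crank_coeff_shift\<close>). And \<open>L\<close> vanishes at every \<open>a\<close>-th root of unity
  other than \<open>1\<close>, because \<open>z powi (a n\<^sub>j + j) = z ^ j\<close> there.

  Multiplying by \<open>theta q (- z)\<close>, which vanishes at the missing root \<open>z = 1\<close>, gives a function whose
  Laurent coefficients satisfy \<open>d\<^bsub>m+a\<^esub> = - (q powi m) * d\<^sub>m\<close>. Such a function is a sum over \<open>r < a\<close> of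
  \<open>d\<^sub>r * z ^ r * theta (q ^ a) (- (q ^ r * z ^ a))\<close>. At \<open>a\<close>-th roots of unity this is a polynomial in
  \<open>z\<close> of degree below \<open>a\<close> with \<open>a\<close> roots, so all its coefficients \<open>d\<^sub>r * theta (q ^ a) (- (q ^ r))\<close>
  are zero; for \<open>0 < r < a\<close> the theta value is nonzero, hence only \<open>d\<^sub>0\<close> survives. Therefore
  \<open>L z * theta q (- z)\<close> is a constant times \<open>theta (q ^ a) (- (z ^ a))\<close>
  (\<open>crank_sum_times_theta\<close>). By the Jacobi triple product the quotient of these two thetas is, up to
  a constant, the product in the theorem. The cancellation of \<open>theta q (- z)\<close> is legitimate off the
  powers of \<open>q\<close>, and extends to them by continuity along the circle through \<open>z\<close>.

  The constant is read off at \<open>z = 1\<close>, where \<open>L\<close> is \<open>a\<close> times the generating function of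
  \<open>a\<close>-cores, \<open>E (q ^ a) ^ a / E q\<close> (\<open>core_generating_function\<close>). That value in turn comes from
  summing the powers of \<open>q\<close> over all integer vectors: the sum factors into \<open>a\<close> thetas whose product
  formulas interlace to \<open>theta q 1\<close>, while a cyclic shift of the beads shows that
  vectors with coordinate sum \<open>k\<close> contribute \<open>q powi (k (k - 1) / 2)\<close> times what those with
  coordinate sum \<open>0\<close> do.
\<close>

section \<open>Theta series\<close>

definition tri :: "int \<Rightarrow> int" where
  "tri k = k * (k - 1) div 2"

lemma two_tri: "2 * tri k = k * (k - 1)"
  unfolding tri_def by simp

lemma tri_add_one: "tri (k + 1) = tri k + k"
  using two_tri[of k] two_tri[of "k + 1"] by (simp add: algebra_simps)

lemma tri_minus: "tri (- k) = tri k + k"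
  using two_tri[of k] two_tri[of "- k"] by (simp add: algebra_simps)

lemma tri_0 [simp]: "tri 0 = 0"
  by (simp add: tri_def)

definition theta :: "complex \<Rightarrow> complex \<Rightarrow> complex" where
  "theta q z = (\<Sum>\<^sub>\<infinity>k. q powi tri k * z powi k)"

lemma theta_term_Suc:
  assumes "q \<noteq> 0" "z \<noteq> 0"
  shows "(q :: complex) powi tri (k + 1) * z powi (k + 1) = (q powi k * z) * (q powi tri k * z powi k)"
  using assms by (simp add: tri_add_one power_int_add)

lemma summable_ratio_tendsto_0:
  fixes f :: "nat \<Rightarrow> 'a :: banach"
  assumes "\<And>n. norm (f (Suc n)) \<le> r n * norm (f n)" and "r \<longlonglongrightarrow> 0"
  shows "summable (\<lambda>n. norm (f n))"
proof -
  from assms(2) have "eventually (\<lambda>n. r n < 1/2) sequentially"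
    by (rule order_tendstoD) auto
  then obtain N where N: "\<And>n. n \<ge> N \<Longrightarrow> r n < 1/2"
    by (auto simp: eventually_sequentially)
  show ?thesis
  proof (rule summable_ratio_test)
    fix n assume "n \<ge> N"
    then have "r n * norm (f n) \<le> 1/2 * norm (f n)"
      using N[of n] by (intro mult_right_mono) auto
    then show "norm (norm (f (Suc n))) \<le> 1/2 * norm (norm (f n))"
      using assms(1)[of n] by simp
  qed auto
qed

lemma summable_on_int:
  fixes f :: "int \<Rightarrow> real"
  assumes "summable (\<lambda>n. norm (f (int n)))" "summable (\<lambda>n. norm (f (- int n)))"
  shows "f summable_on UNIV"
proof -
  have 1: "f summable_on range int"
    using norm_summable_imp_summable_on[OF assms(1)]
    by (subst summable_on_reindex) (auto simp: o_def)
  have 2: "f summable_on range (\<lambda>n. - int n)"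
    using norm_summable_imp_summable_on[OF assms(2)]
    by (subst summable_on_reindex) (auto simp: o_def inj_def)
  have "(UNIV :: int set) = range int \<union> range (\<lambda>n. - int n)"
    by (auto simp: image_iff) (metis int_cases)
  then show ?thesis
    using summable_on_union[OF 1 2] by simp
qed

lemma theta_term_abs_summable:
  fixes q z :: complex
  assumes q: "q \<noteq> 0" "norm q < 1" and z: "z \<noteq> 0"
  shows "(\<lambda>k. norm (q powi tri k * z powi k)) summable_on UNIV"
proof (rule summable_on_int)
  let ?t = "\<lambda>k. q powi tri k * z powi k"
  show "summable (\<lambda>n. norm (norm (?t (int n))))"
  proof (rule summable_ratio_tendsto_0)
    fix n
    show "norm (norm (?t (int (Suc n)))) \<le> (norm q ^ n * norm z) * norm (norm (?t (int n)))"
      using theta_term_Suc[OF q(1) z, of "int n"]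
      by (simp add: add.commute norm_mult norm_power)
    show "(\<lambda>n. norm q ^ n * norm z) \<longlonglongrightarrow> 0"
      using q by (intro tendsto_mult_left_zero LIMSEQ_power_zero) auto
  qed
  show "summable (\<lambda>n. norm (norm (?t (- int n))))"
  proof (rule summable_ratio_tendsto_0)
    fix n
    have "?t (- int n) = (q powi (- int (Suc n)) * z) * ?t (- int (Suc n))"
      using theta_term_Suc[OF q(1) z, of "- int (Suc n)"] by simp
    moreover have "q powi (- int (Suc n)) = inverse (q ^ Suc n)"
      by (metis power_int_minus power_int_of_nat)
    moreover have "q ^ Suc n \<noteq> 0"
      using q by simp
    ultimately have "?t (- int (Suc n)) = (q ^ Suc n / z) * ?t (- int n)"
      using z by (simp only: field_simps) (simp add: field_simps)
    then show "norm (norm (?t (- int (Suc n)))) \<le> (norm q ^ Suc n / norm z) * norm (norm (?t (- int n)))"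
      by (simp add: norm_mult norm_power norm_divide)
    have "(\<lambda>n. norm q ^ Suc n) \<longlonglongrightarrow> 0"
      using q by (intro LIMSEQ_Suc[of "\<lambda>n. norm q ^ n"] LIMSEQ_power_zero) auto
    from tendsto_divide[OF this tendsto_const[of "norm z"]]
    show "(\<lambda>n. norm q ^ Suc n / norm z) \<longlonglongrightarrow> 0"
      using z by simp
  qed
qed

lemma theta_has_sum:
  assumes "q \<noteq> 0" "norm q < 1" "z \<noteq> 0"
  shows "((\<lambda>k. q powi tri k * z powi k) has_sum theta q z) UNIV"
  unfolding theta_def
  using abs_summable_summable[OF theta_term_abs_summable[OF assms]] by simp

section \<open>The Jacobi triple product\<close>

definition qfact :: "complex \<Rightarrow> nat \<Rightarrow> complex" where
  "qfact q n = (\<Prod>k<n. 1 - q ^ Suc k)"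

definition inv_qfact :: "complex \<Rightarrow> int \<Rightarrow> complex" where
  "inv_qfact q k = (if k < 0 then 0 else inverse (qfact q (nat k)))"

lemma one_minus_power_nonzero:
  fixes q :: complex
  assumes "norm q < 1"
  shows "1 - q ^ Suc n \<noteq> 0"
proof
  assume "1 - q ^ Suc n = 0"
  then have "norm q ^ Suc n = 1"
    by (metis eq_iff_diff_eq_0 norm_one norm_power)
  moreover have "norm q ^ Suc n < 1"
    using assms power_le_one[of "norm q" n] mult_le_one[of "norm q" "norm q ^ n"]
    by (smt (verit) mult_left_le norm_ge_zero power_Suc)
  ultimately show False by simp
qed

lemma qfact_nonzero: "norm q < 1 \<Longrightarrow> qfact q n \<noteq> 0"
  unfolding qfact_def using one_minus_power_nonzero by (auto simp del: power_Suc)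

lemma inv_qfact_pred:
  assumes "norm q < 1"
  shows "inv_qfact q (k - 1) = (1 - q powi k) * inv_qfact q k"
proof (cases "k \<ge> 1")
  case True
  then obtain n where k: "k = int (Suc n)"
    by (metis One_nat_def Suc_pred int_one_le_iff_zero_less pos_int_cases)
  have "qfact q (Suc n) = (1 - q ^ Suc n) * qfact q n"
    by (simp add: qfact_def)
  moreover have "nat (1 + int n) = Suc n" by simp
  moreover have "q powi (1 + int n) = q ^ Suc n"
    by (metis of_nat_Suc power_int_of_nat)
  ultimately show ?thesis
    using one_minus_power_nonzero[OF assms, of n] qfact_nonzero[OF assms]
    unfolding k inv_qfact_def by (simp del: power_Suc)
next
  case False
  then show ?thesis by (cases "k = 0") (auto simp: inv_qfact_def)
qed

lemma has_sum_int_shift: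
  "((\<lambda>k. f (k + c)) has_sum s) (UNIV :: int set) \<longleftrightarrow> (f has_sum s) UNIV"
  by (rule has_sum_reindex_bij_betw[of "\<lambda>k. k + c" UNIV UNIV f]) (rule bij_betwI[of _ _ _ "\<lambda>k. k - c"], auto)

text \<open>
  The coefficients are Gaussian binomials \<open>[m + n, n + j]\<close>. Since \<open>inv_qfact\<close> is zero on negative
  arguments, the recurrence \<open>inv_qfact_pred\<close> holds for all integers, and both induction steps are
  the two \<open>q\<close>-Pascal rules without boundary cases.
\<close>

lemma finite_jacobi_triple_product:
  fixes q z :: complex
  assumes q: "q \<noteq> 0" "norm q < 1" and z: "z \<noteq> 0"
  shows "((\<lambda>j. q powi tri j * z powi j *
            (qfact q (m + n) * inv_qfact q (int n + j) * inv_qfact q (int m - j)))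
          has_sum (\<Prod>k<m. 1 + z * q ^ k) * (\<Prod>k<n. 1 + q ^ Suc k / z)) UNIV"
proof (induction m)
  case 0
  show ?case
  proof (induction n)
    case 0
    show ?case
      by (rule has_sum_finite_neutralI[of "{0}"]) (auto simp: inv_qfact_def qfact_def)
  next
    case (Suc n)
    let ?R = "inv_qfact q" and ?t = "\<lambda>j. q powi tri j * z powi j"
    let ?F = "\<lambda>j. ?t j * (qfact q n * ?R (int n + j) * ?R (- j))"
    define P where "P = (\<Prod>k<n. 1 + q ^ Suc k / z)"
    have F: "(?F has_sum P) UNIV"
      using Suc by (simp add: P_def)
    then have "((\<lambda>j. q ^ Suc n / z * ?F (j + 1)) has_sum q ^ Suc n / z * P) UNIV"
      using has_sum_int_shift[of ?F 1 P] by (intro has_sum_cmult_right) simp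
    with F have "((\<lambda>j. ?F j + q ^ Suc n / z * ?F (j + 1)) has_sum P + q ^ Suc n / z * P) UNIV"
      by (rule has_sum_add)
    moreover have "?F j + q ^ Suc n / z * ?F (j + 1) =
        ?t j * (qfact q (Suc n) * ?R (int (Suc n) + j) * ?R (- j))" for j
    proof -
      have e1: "?R (int n + j) = (1 - q powi (int n + j + 1)) * ?R (int n + j + 1)"
        using inv_qfact_pred[OF q(2), of "int n + j + 1"] by simp
      have e2: "?R (- j - 1) = (1 - q powi (- j)) * ?R (- j)"
        by (rule inv_qfact_pred[OF q(2)])
      have e3: "?t (j + 1) = (q powi j * z) * ?t j"
        by (rule theta_term_Suc[OF q(1) z])
      have e4: "q powi (- j) * q powi j = 1"
        using q by (simp flip: power_int_add)
      have e5: "q powi (int n + j + 1) = q ^ Suc n * q powi j"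
        using q by (simp add: power_int_add)
      have e6: "qfact q (Suc n) = (1 - q ^ Suc n) * qfact q n"
        by (simp add: qfact_def)
      have i: "int n + (j + 1) = int n + j + 1" "int (Suc n) + j = int n + j + 1" "- (j + 1) = - j - 1"
        by simp_all
      define A B C D G where "A = ?R (int n + j + 1)" and "B = ?R (-j)" and "C = q ^ Suc n"
        and "D = q powi j" and "G = q powi (-j)"
      have DG: "G * D = 1" unfolding D_def G_def by (rule e4)
      have "(1 - C * D) * B + C * D * ((1 - G) * B) = (1 - C) * B"
        using DG by algebra
      then have "?t j * qfact q n * A * ((1 - C * D) * B + C * D * ((1 - G) * B)) =
          ?t j * qfact q n * A * ((1 - C) * B)" by simp
      then show ?thesis
        unfolding i e1 e2 e3 e5 e6 A_def[symmetric] B_def[symmetric] C_def[symmetric] D_def[symmetric] G_def[symmetric]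
        using z by (simp add: algebra_simps)
    qed
    moreover have "P + q ^ Suc n / z * P = (\<Prod>k<Suc n. 1 + q ^ Suc k / z)"
      by (simp add: P_def algebra_simps)
    ultimately show ?case by simp
  qed
next
  case (Suc m)
  let ?R = "inv_qfact q" and ?t = "\<lambda>j. q powi tri j * z powi j"
  let ?F = "\<lambda>j. ?t j * (qfact q (m + n) * ?R (int n + j) * ?R (int m - j))"
  define P where "P = (\<Prod>k<m. 1 + z * q ^ k) * (\<Prod>k<n. 1 + q ^ Suc k / z)"
  have F: "(?F has_sum P) UNIV"
    using Suc by (simp add: P_def)
  then have "((\<lambda>j. z * q ^ m * ?F (j - 1)) has_sum z * q ^ m * P) UNIV"
    using has_sum_int_shift[of ?F "- 1" P] by (intro has_sum_cmult_right) simp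
  with F have "((\<lambda>j. ?F j + z * q ^ m * ?F (j - 1)) has_sum P + z * q ^ m * P) UNIV"
    by (rule has_sum_add)
  moreover have "?F j + z * q ^ m * ?F (j - 1) =
      ?t j * (qfact q (Suc m + n) * ?R (int n + j) * ?R (int (Suc m) - j))" for j
  proof -
    have e1: "?R (int m - j) = (1 - q powi (int m + 1 - j)) * ?R (int m + 1 - j)"
      using inv_qfact_pred[OF q(2), of "int m + 1 - j"] by simp
    have e2: "?R (int n + j - 1) = (1 - q powi (int n + j)) * ?R (int n + j)"
      by (rule inv_qfact_pred[OF q(2)])
    have e3: "?t j = (q powi (j - 1) * z) * ?t (j - 1)"
      using theta_term_Suc[OF q(1) z, of "j - 1"] by simp
    have e4: "q ^ m = q powi (int m + 1 - j) * q powi (j - 1)"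
      using q by (simp flip: power_int_add)
    have e5: "q ^ Suc (m + n) = q powi (int m + 1 - j) * q powi (int n + j)"
    proof -
      have "q powi (int m + 1 - j) * q powi (int n + j) = q powi (int m + 1 - j + (int n + j))"
        using q by (simp only: power_int_add simp_thms)
      also have "int m + 1 - j + (int n + j) = int (Suc (m + n))" by simp
      finally show ?thesis by (metis power_int_of_nat)
    qed
    have e6: "qfact q (Suc m + n) = (1 - q ^ Suc (m + n)) * qfact q (m + n)"
      by (simp add: qfact_def)
    have i: "int n + (j - 1) = int n + j - 1" "int (Suc m) - j = int m + 1 - j" "int m - (j - 1) = int m + 1 - j"
      by simp_all
    show ?thesis
      unfolding i e1 e2 e6 e5 e4
      by (subst (1 2) e3) (simp add: algebra_simps)
  qed
  moreover have "P + z * q ^ m * P = (\<Prod>k<Suc m. 1 + z * q ^ k) * (\<Prod>k<n. 1 + q ^ Suc k / z)"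
    by (simp add: P_def algebra_simps)
  ultimately show ?case by simp
qed

lemma infsum_dominated_convergence:
  fixes f :: "nat \<Rightarrow> 'a \<Rightarrow> 'b :: banach"
  assumes "M summable_on X" and "\<And>n x. x \<in> X \<Longrightarrow> norm (f n x) \<le> M x"
    and "\<And>x. x \<in> X \<Longrightarrow> (\<lambda>n. f n x) \<longlonglongrightarrow> g x"
  shows "(\<lambda>n. infsum (f n) X) \<longlonglongrightarrow> infsum g X"
proof -
  have g: "norm (g x) \<le> M x" if "x \<in> X" for x
    using assms(3)[OF that] assms(2)[OF that] by (intro Lim_bounded[OF tendsto_norm]) auto
  have gs: "g summable_on X"
    using abs_summable_summable Infinite_Sum.abs_summable_on_comparison_test'[OF assms(1) g] by blast
  show ?thesis
  proof (rule swap_uniform_limit'[where f = "\<lambda>Y n. \<Sum>x\<in>Y. f n x" and F = "finite_subsets_at_top X"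
        and G = sequentially and S = UNIV])
    show "\<forall>\<^sub>F Y in finite_subsets_at_top X. ((\<lambda>n. \<Sum>x\<in>Y. f n x) \<longlongrightarrow> (\<Sum>x\<in>Y. g x)) sequentially"
      by (intro eventually_finite_subsets_at_top_weakI tendsto_sum) (use assms(3) in auto)
    show "((\<lambda>Y. \<Sum>x\<in>Y. g x) \<longlongrightarrow> infsum g X) (finite_subsets_at_top X)"
      using gs by (simp add: infsum_tendsto)
    show "uniform_limit UNIV (\<lambda>Y n. \<Sum>x\<in>Y. f n x) (\<lambda>n. infsum (f n) X) (finite_subsets_at_top X)"
      by (rule Weierstrass_m_test_general[OF _ assms(1)]) (use assms(2) in auto)
  qed auto
qed

lemma convergent_prodI_norm:
  fixes u :: "nat \<Rightarrow> complex"
  assumes "summable (\<lambda>n. norm (u n - 1))"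
  shows "convergent_prod u"
  using assms abs_convergent_prod_conv_summable abs_convergent_prod_imp_convergent_prod by blast

lemma summable_norm_geometric:
  fixes q c :: complex
  assumes "norm q < 1"
  shows "summable (\<lambda>n. norm (c * q ^ n))"
  using assms by (simp add: norm_mult norm_power summable_mult)

lemma convergent_prod_one_plus_geometric:
  fixes q c :: complex
  assumes "norm q < 1"
  shows "convergent_prod (\<lambda>n. 1 + c * q ^ n)"
  by (rule convergent_prodI_norm) (simp add: summable_norm_geometric assms)

lemma convergent_prod_LIMSEQ_lessThan:
  fixes u :: "nat \<Rightarrow> complex"
  assumes "convergent_prod u"
  shows "(\<lambda>n. \<Prod>k<n. u k) \<longlonglongrightarrow> prodinf u"
  using convergent_prod_LIMSEQ[OF assms] LIMSEQ_lessThan_iff_atMost by blast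

lemma E_nonzero: "norm q < 1 \<Longrightarrow> E q \<noteq> 0"
  unfolding E_def by (intro prodinf_nonzero convergent_prod_E one_minus_power_nonzero)

lemma qfact_tendsto_E: "norm q < 1 \<Longrightarrow> qfact q \<longlonglongrightarrow> E q"
  unfolding qfact_def[abs_def] E_def by (intro convergent_prod_LIMSEQ_lessThan convergent_prod_E)

definition theta_prod :: "complex \<Rightarrow> complex \<Rightarrow> complex" where
  "theta_prod q z = (\<Prod>n. (1 + z * q ^ n) * (1 + q ^ Suc n / z))"

lemma convergent_theta_factors:
  fixes q z :: complex
  assumes "norm q < 1"
  shows "convergent_prod (\<lambda>n. 1 + z * q ^ n)" "convergent_prod (\<lambda>n. 1 + q ^ Suc n / z)"
    "convergent_prod (\<lambda>n. (1 + z * q ^ n) * (1 + q ^ Suc n / z))"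
proof -
  show 1: "convergent_prod (\<lambda>n. 1 + z * q ^ n)"
    by (rule convergent_prod_one_plus_geometric[OF assms])
  show 2: "convergent_prod (\<lambda>n. 1 + q ^ Suc n / z)"
    using convergent_prod_one_plus_geometric[OF assms, of "q / z"] by simp
  show "convergent_prod (\<lambda>n. (1 + z * q ^ n) * (1 + q ^ Suc n / z))"
    by (rule convergent_prod_mult[OF 1 2])
qed

text \<open>
  Let \<open>m = n\<close> tend to infinity in the finite identity: each Gaussian binomial tends to \<open>1 / E q\<close>, and
  all of them are bounded by one constant, so the theta series itself dominates.
\<close>

theorem jacobi_triple_product:
  fixes q z :: complex
  assumes q: "q \<noteq> 0" "norm q < 1" and z: "z \<noteq> 0"
  shows "theta q z = E q * theta_prod q z"
proof -
  let ?R = "inv_qfact q" and ?t = "\<lambda>j. q powi tri j * z powi j"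
  let ?f = "\<lambda>n j. ?t j * (qfact q (n + n) * ?R (int n + j) * ?R (int n - j))"
  have inv_lim: "(\<lambda>n. inverse (qfact q n)) \<longlonglongrightarrow> inverse (E q)"
    by (intro tendsto_inverse qfact_tendsto_E q E_nonzero)
  obtain A where A: "A > 0" "\<And>n. norm (qfact q n) \<le> A"
    using convergent_imp_Bseq[OF convergentI[OF qfact_tendsto_E[OF q(2)]]] by (auto elim: BseqE)
  obtain B where B: "B > 0" "\<And>n. norm (inverse (qfact q n)) \<le> B"
    using convergent_imp_Bseq[OF convergentI[OF inv_lim]] by (auto elim: BseqE)
  have R: "norm (?R k) \<le> B" for k
    using B by (simp add: inv_qfact_def)
  have R_lim: "(\<lambda>n. ?R (int n + j)) \<longlonglongrightarrow> inverse (E q)" for j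
  proof -
    have "filterlim (\<lambda>n. nat (int n + j)) sequentially sequentially"
      unfolding filterlim_at_top eventually_sequentially
    proof
      fix Z show "\<exists>N. \<forall>n\<ge>N. Z \<le> nat (int n + j)"
        by (rule exI[of _ "Z + nat \<bar>j\<bar>"]) auto
    qed
    from filterlim_compose[OF inv_lim this]
    have "(\<lambda>n. inverse (qfact q (nat (int n + j)))) \<longlonglongrightarrow> inverse (E q)" .
    then show ?thesis
    proof (rule Lim_transform_eventually)
      show "eventually (\<lambda>n. inverse (qfact q (nat (int n + j))) = ?R (int n + j)) sequentially"
        unfolding eventually_sequentially inv_qfact_def by (intro exI[of _ "nat \<bar>j\<bar>"]) auto
    qed
  qed
  have "(\<lambda>n. infsum (?f n) UNIV) \<longlonglongrightarrow> infsum (\<lambda>j. ?t j * (E q * inverse (E q) * inverse (E q))) UNIV"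
  proof (rule infsum_dominated_convergence)
    show "(\<lambda>j. norm (?t j) * (A * B * B)) summable_on UNIV"
      by (intro summable_on_cmult_left theta_term_abs_summable assms)
    show "norm (?f n j) \<le> norm (?t j) * (A * B * B)" for n j
      unfolding norm_mult using A B R by (intro mult_mono mult_nonneg_nonneg) auto
    have 2: "(\<lambda>n. qfact q (n + n)) \<longlonglongrightarrow> E q"
      using LIMSEQ_subseq_LIMSEQ[OF qfact_tendsto_E[OF q(2)], of "\<lambda>n. n + n"]
      by (simp add: o_def strict_mono_def)
    show "(\<lambda>n. ?f n j) \<longlonglongrightarrow> ?t j * (E q * inverse (E q) * inverse (E q))" for j
      using R_lim[of j] R_lim[of "-j"] 2 by (intro tendsto_intros) auto
  qed
  moreover have "infsum (?f n) UNIV = (\<Prod>k<n. (1 + z * q ^ k) * (1 + q ^ Suc k / z))" for n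
    using infsumI[OF finite_jacobi_triple_product[OF assms, of n n]]
    by (simp add: prod.distrib)
  moreover have "(\<lambda>n. \<Prod>k<n. (1 + z * q ^ k) * (1 + q ^ Suc k / z)) \<longlonglongrightarrow> theta_prod q z"
    unfolding theta_prod_def
    by (intro convergent_prod_LIMSEQ_lessThan convergent_theta_factors q)
  ultimately have "theta_prod q z = infsum (\<lambda>j. ?t j * (E q * inverse (E q) * inverse (E q))) UNIV"
    using LIMSEQ_unique by simp
  also have "\<dots> = theta q z * inverse (E q)"
    using E_nonzero[OF q(2)] by (simp add: theta_def infsum_cmult_left')
  finally show ?thesis
    using E_nonzero[OF q(2)] by (simp add: field_simps)
qed

section \<open>Zeros and interlacing of theta products\<close>

lemma power_int_inj:
  fixes q :: complex
  assumes "q \<noteq> 0" "norm q < 1" "norm q powi m = norm q powi n"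
  shows "m = n"
proof (rule ccontr)
  assume "m \<noteq> n"
  then consider "m < n" | "n < m" by linarith
  then show False
    using power_int_strict_decreasing[of m n "norm q"] power_int_strict_decreasing[of n m "norm q"] assms
    by cases auto
qed

text \<open>
  A convergent product vanishes only if one of its factors does, and the factors of \<open>theta_prod q z\<close>
  vanish exactly at the negatives of the integer powers of \<open>q\<close>.
\<close>

lemma theta_nonzero:
  fixes q z :: complex
  assumes q: "q \<noteq> 0" "norm q < 1" and z: "z \<noteq> 0" and "\<And>m :: int. z \<noteq> - (q powi m)"
  shows "theta q z \<noteq> 0"
proof -
  have 1: "1 + z * q ^ n \<noteq> 0" for n
  proof
    assume "1 + z * q ^ n = 0"
    then have "z * q ^ n = - 1" by (simp add: eq_neg_iff_add_eq_0 add.commute)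
    then have "z = - (q powi (- int n))"
      using q by (simp add: power_int_minus field_simps)
    with assms(4) show False by blast
  qed
  have 2: "1 + q ^ Suc n / z \<noteq> 0" for n
  proof
    assume "1 + q ^ Suc n / z = 0"
    then have "z = - (q ^ Suc n)" 
      using z by (simp add: field_simps add_eq_0_iff del: power_Suc)
    then have "z = - (q powi (int (Suc n)))" by (metis power_int_of_nat)
    with assms(4) show False by blast
  qed
  have "theta_prod q z \<noteq> 0"
    unfolding theta_prod_def using 1 2 convergent_theta_factors[OF q(2)]
    by (intro prodinf_nonzero) auto
  then show ?thesis
    using jacobi_triple_product[OF q z] E_nonzero[OF q(2)] by simp
qed

lemma theta_minus_one:
  fixes q :: complex
  assumes q: "q \<noteq> 0" "norm q < 1"
  shows "theta q (- 1) = 0"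
proof -
  have "theta_prod q (- 1) = 0"
    unfolding theta_prod_def
    using convergent_prod_LIMSEQ_lessThan[OF convergent_theta_factors(3)[OF q(2), of "- 1"]]
  proof (rule LIMSEQ_unique)
    \<comment> \<open>The factor with \<open>k = 0\<close> is zero, so all nonempty partial products are.\<close>
    have "eventually (\<lambda>n. (\<Prod>k<n. (1 + - 1 * q ^ k) * (1 + q ^ Suc k / - 1)) = 0) sequentially"
      unfolding eventually_sequentially by (rule exI[of _ 1]) (auto intro!: bexI[of _ 0])
    then show "(\<lambda>n. \<Prod>k<n. (1 + - 1 * q ^ k) * (1 + q ^ Suc k / - 1)) \<longlonglongrightarrow> 0"
      by (rule tendsto_eventually)
  qed
  then show ?thesis
    using jacobi_triple_product[of q "- 1"] q by simp
qed

lemma prodinf_group: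
  fixes g :: "nat \<Rightarrow> complex"
  assumes "a > 0" "convergent_prod g" "\<And>i. i < a \<Longrightarrow> convergent_prod (\<lambda>n. g (n * a + i))"
  shows "(\<Prod>i<a. \<Prod>n. g (n * a + i)) = prodinf g"
proof -
  have "(\<lambda>N. \<Prod>n<N. \<Prod>i<a. g (n * a + i)) \<longlonglongrightarrow> (\<Prod>n. \<Prod>i<a. g (n * a + i))"
    by (intro convergent_prod_LIMSEQ_lessThan convergent_prod_prod) (use assms in auto)
  moreover have "(\<Prod>n<N. \<Prod>i<a. g (n * a + i)) = (\<Prod>n<N * a. g n)" for N
  proof -
    have "(\<Prod>i<a. g (n * a + i)) = prod g {n * a..<n * a + a}" for n
      using prod.shift_bounds_nat_ivl[of g 0 "n * a" a] 
      by (simp add: atLeast0LessThan add.commute)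
    then show ?thesis
      using prod.nat_group[of g a N] by simp
  qed
  moreover have "(\<lambda>N. \<Prod>n<N * a. g n) \<longlonglongrightarrow> prodinf g"
    using LIMSEQ_subseq_LIMSEQ[OF convergent_prod_LIMSEQ_lessThan[OF assms(2)], of "\<lambda>N. N * a"] assms(1)
    by (simp add: o_def strict_mono_def)
  ultimately have "(\<Prod>n. \<Prod>i<a. g (n * a + i)) = prodinf g"
    using LIMSEQ_unique by auto
  then show ?thesis
    using prodinf_prod[of "{..<a}" "\<lambda>i n. g (n * a + i)"] assms(3) by auto
qed

text \<open>
  In the product formula for \<open>theta (q ^ a) (q ^ i)\<close> the exponents of \<open>q\<close> are \<open>a n + i\<close> in the first
  family of factors and \<open>a (n + 1) - i\<close> in the second. As \<open>i\<close> runs through the residues, the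
  first takes every value \<open>0, 1, 2, \<dots>\<close> once and the second, going through the residues backwards,
  every value \<open>1, 2, 3, \<dots>\<close> once; these are the two families of exponents in \<open>theta_prod q 1\<close>.
\<close>

lemma prod_theta_residues:
  fixes q :: complex
  assumes a: "a > 0" and q: "q \<noteq> 0" "norm q < 1"
  shows "(\<Prod>i<a. theta (q ^ a) (q ^ i)) = E (q ^ a) ^ a / E q * theta q 1"
proof -
  have qa: "q ^ a \<noteq> 0" "norm (q ^ a) < 1"
    using a q by (auto simp: norm_power power_less_one_iff)
  let ?g = "\<lambda>n. 1 + q ^ n" and ?h = "\<lambda>n. 1 + q ^ Suc n"
  have g: "convergent_prod ?g" and h: "convergent_prod ?h"
    using convergent_theta_factors(1,2)[OF q(2), of 1] by simp_all
  have split: "q ^ (n * a + i) = q ^ i * (q ^ a) ^ n" for n i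
    by (simp add: power_add mult.commute flip: power_mult)
  have gi: "convergent_prod (\<lambda>n. ?g (n * a + i))" for i
    using convergent_theta_factors(1)[OF qa(2), of "q ^ i"] by (simp only: split)
  have hi: "convergent_prod (\<lambda>n. ?h (n * a + i))" for i
    using convergent_theta_factors(1)[OF qa(2), of "q ^ Suc i"]
    by (simp only: split flip: add_Suc_right)
  have "theta_prod (q ^ a) (q ^ i) = (\<Prod>n. ?g (n * a + i)) * (\<Prod>n. ?h (n * a + (a - Suc i)))" if "i < a" for i
  proof -
    have "(q ^ a) ^ Suc n / q ^ i = q ^ Suc (n * a + (a - Suc i))" for n
    proof -
      have "a * Suc n = i + Suc (n * a + (a - Suc i))"
        using that by simp
      then have "(q ^ a) ^ Suc n = q ^ i * q ^ Suc (n * a + (a - Suc i))"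
        by (metis power_add power_mult)
      then show ?thesis using q by simp
    qed
    then show ?thesis
      unfolding theta_prod_def prodinf_mult[OF gi hi] by (simp only: split)
  qed
  then have "(\<Prod>i<a. theta_prod (q ^ a) (q ^ i)) =
      (\<Prod>i<a. \<Prod>n. ?g (n * a + i)) * (\<Prod>i<a. \<Prod>n. ?h (n * a + (a - Suc i)))"
    by (simp add: prod.distrib)
  also have "(\<Prod>i<a. \<Prod>n. ?h (n * a + (a - Suc i))) = (\<Prod>i<a. \<Prod>n. ?h (n * a + i))"
    by (rule prod.nat_diff_reindex)
  also have "(\<Prod>i<a. \<Prod>n. ?g (n * a + i)) * (\<Prod>i<a. \<Prod>n. ?h (n * a + i)) = prodinf ?g * prodinf ?h"
    using prodinf_group[OF a g gi] prodinf_group[OF a h hi] by simp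
  also have "\<dots> = theta_prod q 1"
    unfolding theta_prod_def prodinf_mult[OF g h] by simp
  finally have "(\<Prod>i<a. theta_prod (q ^ a) (q ^ i)) = theta_prod q 1" .
  moreover have "theta (q ^ a) (q ^ i) = E (q ^ a) * theta_prod (q ^ a) (q ^ i)" for i
    by (rule jacobi_triple_product) (use qa q in auto)
  ultimately show ?thesis
    using jacobi_triple_product[OF q, of 1] E_nonzero[OF q(2)] by (simp add: prod.distrib)
qed

section \<open>Laurent series with quasi-periodic coefficients\<close>

lemma quasiperiodic_coeff:
  fixes d :: "int \<Rightarrow> complex"
  assumes "q \<noteq> 0" "s \<noteq> 0" and d: "\<And>k. d (k + int N) = s * q powi k * d k"
  shows "d (int N * m + r) = s powi m * q powi (int N * tri m + r * m) * d r"
proof -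
  define e where "e m = s powi m * q powi (int N * tri m + r * m) * d r" for m
  have e: "e (m + 1) = s * q powi (int N * m + r) * e m" for m
  proof -
    have "int N * tri (m + 1) + r * (m + 1) = (int N * m + r) + (int N * tri m + r * m)"
      unfolding tri_add_one by (simp add: algebra_simps)
    then show ?thesis
      using assms(1,2) by (simp add: e_def power_int_add)
  qed
  have d': "d (int N * (m + 1) + r) = s * q powi (int N * m + r) * d (int N * m + r)" for m
    using d[of "int N * m + r"] by (simp add: algebra_simps)
  have "d (int N * m + r) = e m"
  proof (induction m rule: int_induct[of _ 0])
    case base
    then show ?case by (simp add: e_def)
  next
    case (step1 i)
    then show ?case using e[of i] d'[of i] by simp
  next
    case (step2 i)
    then show ?case using e[of "i - 1"] d'[of "i - 1"] assms(1,2) by simp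
  qed
  then show ?thesis by (simp add: e_def)
qed

text \<open>
  The recurrence determines the coefficients from those with index \<open>0, \<dots>, N - 1\<close>, and within one
  residue class modulo \<open>N\<close> they are, by \<open>quasiperiodic_coeff\<close>, the coefficients of a theta series of
  nome \<open>q ^ N\<close>.
\<close>

lemma quasiperiodic_laurent_series:
  fixes d :: "int \<Rightarrow> complex"
  assumes q: "q \<noteq> 0" "norm q < 1" and s: "s \<noteq> 0" and z: "z \<noteq> 0" and N: "N > 0"
    and d: "\<And>k. d (k + int N) = s * q powi k * d k"
    and sum: "((\<lambda>k. d k * z powi k) has_sum f) UNIV"
  shows "f = (\<Sum>r<N. d (int r) * z ^ r * theta (q ^ N) (s * q ^ r * z ^ N))"
proof -
  have qN: "q ^ N \<noteq> 0" "norm (q ^ N) < 1"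
    using N q by (auto simp: norm_power power_less_one_iff)
  let ?h = "\<lambda>(r, m). d (int N * m + int r) * z powi (int N * m + int r)"
  have "bij_betw (\<lambda>(r, m). int N * m + int r) ({..<N} \<times> UNIV) UNIV"
    by (rule bij_betwI[of _ _ _ "\<lambda>k. (nat (k mod int N), k div int N)"]) (use N in \<open>auto simp: nat_less_iff\<close>)
  from has_sum_reindex_bij_betw[OF this, of "\<lambda>k. d k * z powi k" f] sum
  have "(?h has_sum f) ({..<N} \<times> UNIV)"
    by (simp add: case_prod_unfold)
  moreover have "((\<lambda>m. ?h (r, m)) has_sum d (int r) * z ^ r * theta (q ^ N) (s * q ^ r * z ^ N)) UNIV" for r
  proof -
    have "s * q ^ r * z ^ N \<noteq> 0" using q z s by simp
    from has_sum_cmult_right[OF theta_has_sum[OF qN this], of "d (int r) * z ^ r"]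
    show ?thesis
    proof (rule has_sum_cong[THEN iffD1, rotated])
      fix m
      have 1: "(q ^ N) powi tri m = q powi (int N * tri m)"
        by (simp add: power_int_mult)
      have 2: "(s * q ^ r * z ^ N) powi m = s powi m * q powi (int r * m) * z powi (int N * m)"
        by (simp add: power_int_mult_distrib power_int_mult)
      show "d (int r) * z ^ r * ((q ^ N) powi tri m * (s * q ^ r * z ^ N) powi m) = ?h (r, m)"
        unfolding 1 2 using quasiperiodic_coeff[OF q(1) s d, of m "int r"] q z
        by (simp add: power_int_add algebra_simps)
    qed
  qed
  ultimately have "((\<lambda>r. d (int r) * z ^ r * theta (q ^ N) (s * q ^ r * z ^ N)) has_sum f) {..<N}"
    by (rule has_sum_SigmaD)
  then show ?thesis
    by (simp add: has_sum_finite_iff)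
qed

text \<open>
  The Cauchy product for two-sided series, obtained by summing the absolutely convergent double
  series along the lines \<open>k + l = m\<close>.
\<close>

lemma laurent_product:
  fixes c t :: "int \<Rightarrow> complex"
  assumes z: "z \<noteq> 0"
    and c: "((\<lambda>k. c k * z powi k) has_sum C) UNIV" and t: "((\<lambda>k. t k * z powi k) has_sum T) UNIV"
  shows "((\<lambda>m. (\<Sum>\<^sub>\<infinity>k. c k * t (m - k)) * z powi m) has_sum C * T) UNIV"
proof -
  let ?f = "\<lambda>(k, l). (c k * z powi k) * (t l * z powi l)"
  have "(\<lambda>p. norm (?f p)) summable_on UNIV \<times> UNIV"
  proof (intro Infinite_Sum.abs_summable_on_Sigma_iff[THEN iffD2] conjI ballI)
    have cs: "(\<lambda>k. norm (c k * z powi k)) summable_on UNIV"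
      using c by (simp add: summable_on_iff_abs_summable_on_complex[symmetric] has_sum_imp_summable)
    have ts: "(\<lambda>k. norm (t k * z powi k)) summable_on UNIV"
      using t by (simp add: summable_on_iff_abs_summable_on_complex[symmetric] has_sum_imp_summable)
    show "(\<lambda>l. norm (?f (k, l))) summable_on UNIV" for k
      using summable_on_cmult_right[OF ts, of "norm (c k * z powi k)"] by (simp add: norm_mult)
    have "(\<Sum>\<^sub>\<infinity>l. norm (?f (k, l))) = norm (c k * z powi k) * (\<Sum>\<^sub>\<infinity>l. norm (t l * z powi l))" for k
      by (simp add: norm_mult infsum_cmult_right')
    then show "(\<lambda>k. norm (\<Sum>\<^sub>\<infinity>l. norm (?f (k, l)))) summable_on UNIV"
      using summable_on_cmult_left[OF cs, of "\<bar>\<Sum>\<^sub>\<infinity>l. norm (t l * z powi l)\<bar>"]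
      by (simp only: norm_mult real_norm_def abs_mult abs_norm_cancel)
  qed
  then have sum: "?f summable_on UNIV \<times> UNIV" by (rule abs_summable_summable)
  have "(?f has_sum C * T) (UNIV \<times> UNIV)"
  proof (rule has_sum_SigmaI[OF _ _ sum])
    show "((\<lambda>l. ?f (k, l)) has_sum c k * z powi k * T) UNIV" for k
      using has_sum_cmult_right[OF t, of "c k * z powi k"] by simp
    show "((\<lambda>k. c k * z powi k * T) has_sum C * T) UNIV"
      using c by (rule has_sum_cmult_left)
  qed
  moreover have bij: "bij_betw (\<lambda>(m, k). (k, m - k)) (UNIV \<times> UNIV) (UNIV \<times> (UNIV :: int set))"
    by (rule bij_betwI[of _ _ _ "\<lambda>(k, l). (k + l, k)"]) auto
  ultimately have "((\<lambda>p. ?f (case p of (m, k) \<Rightarrow> (k, m - k))) has_sum C * T) (UNIV \<times> UNIV)"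
    using has_sum_reindex_bij_betw[OF bij, of ?f "C * T"] by blast
  moreover have "?f (case p of (m, k) \<Rightarrow> (k, m - k)) = (case p of (m, k) \<Rightarrow> (c k * t (m - k)) * z powi m)" for p
  proof -
    have "z powi fst p = z powi snd p * z powi (fst p - snd p)"
      using z by (simp flip: power_int_add)
    then show ?thesis by (simp add: case_prod_unfold)
  qed
  ultimately have *: "((\<lambda>(m, k). (c k * t (m - k)) * z powi m) has_sum C * T) (UNIV \<times> UNIV)"
    by simp
  show ?thesis
  proof (rule has_sum_SigmaD[OF *])
    fix m :: int
    have "(\<lambda>k. (c k * t (m - k)) * z powi m) summable_on UNIV"
      using summable_on_SigmaD1[of "\<lambda>m k. (c k * t (m - k)) * z powi m" UNIV "\<lambda>_. UNIV" m] has_sum_imp_summable[OF *]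
      by auto
    from has_sum_infsum[OF this]
    show "((\<lambda>k. case (m, k) of (m, k) \<Rightarrow> (c k * t (m - k)) * z powi m) has_sum
        (\<Sum>\<^sub>\<infinity>k. c k * t (m - k)) * z powi m) UNIV"
      by (simp add: infsum_cmult_left')
  qed
qed

section \<open>Weighted sums over integer vectors\<close>

lemma summable_prod_PiE_nonneg:
  fixes h :: "'a \<Rightarrow> 'b \<Rightarrow> real"
  assumes "finite A" "\<And>x. x \<in> A \<Longrightarrow> h x summable_on B x" "\<And>x y. h x y \<ge> 0"
  shows "(\<lambda>g. \<Prod>x\<in>A. h x (g x)) summable_on PiE A B"
  using assms(1,2)
proof (induction rule: finite_induct)
  case empty
  then show ?case by simp
next
  case (insert x F)
  have pi: "PiE (insert x F) B = (\<lambda>(g, y). g(x := y)) ` (PiE F B \<times> B x)"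
    unfolding PiE_insert_eq
    by (subst swap_product [symmetric]) (simp add: image_image case_prod_unfold)
  have inj: "inj_on (\<lambda>(g, y). g(x := y)) (PiE F B \<times> B x)"
    using insert.hyps by (intro inj_combinator')
  have "(\<Prod>i\<in>insert x F. h i ((g(x := y)) i)) = (\<Prod>i\<in>F. h i (g i)) * h x y" for g y
  proof -
    have "(\<Prod>i\<in>F. h i ((g(x := y)) i)) = (\<Prod>i\<in>F. h i (g i))"
      using insert.hyps by (intro prod.cong) auto
    then show ?thesis using insert.hyps by simp
  qed
  then have eq: "(\<lambda>g. \<Prod>i\<in>insert x F. h i (g i)) \<circ> (\<lambda>(g, y). g(x := y)) =
      (\<lambda>(g, y). (\<Prod>i\<in>F. h i (g i)) * h x y)"
    by (simp add: fun_eq_iff)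
  have "(\<lambda>(g, y). (\<Prod>i\<in>F. h i (g i)) * h x y) summable_on PiE F B \<times> B x"
  proof (rule summable_on_SigmaI)
    show "((\<lambda>y. case (g, y) of (g, y) \<Rightarrow> (\<Prod>i\<in>F. h i (g i)) * h x y) has_sum
        (\<Prod>i\<in>F. h i (g i)) * infsum (h x) (B x)) (B x)" for g
      using insert.prems by (auto intro!: has_sum_cmult_right has_sum_infsum)
    show "(\<lambda>g. (\<Prod>i\<in>F. h i (g i)) * infsum (h x) (B x)) summable_on PiE F B"
      using insert by (intro summable_on_cmult_left) auto
  qed (use assms(3) in \<open>auto intro!: mult_nonneg_nonneg prod_nonneg\<close>)
  then show ?case
    unfolding pi summable_on_reindex[OF inj] eq .
qed

lemma power_int_sum:
  fixes q :: "'a :: field"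
  assumes "q \<noteq> 0"
  shows "q powi (\<Sum>i\<in>A. f i) = (\<Prod>i\<in>A. q powi f i)"
  using assms by (induction A rule: infinite_finite_induct) (auto simp: power_int_add)

definition vecs :: "nat \<Rightarrow> (nat \<Rightarrow> int) set" where
  "vecs a = {..<a} \<rightarrow>\<^sub>E UNIV"

text \<open>
  On vectors with coordinate sum \<open>0\<close> this is the exponent of \<open>q\<close> in the theorem. Replacing the
  quadratic part \<open>n\<^sub>i\<^sup>2 / 2\<close> by \<open>tri (n i)\<close> keeps it an integer on all vectors.
\<close>

definition weight :: "nat \<Rightarrow> (nat \<Rightarrow> int) \<Rightarrow> int" where
  "weight a n = (\<Sum>i<a. int a * tri (n i) + int i * n i)"

lemma zero_sum_vecs_iff: "n \<in> zero_sum_vecs a \<longleftrightarrow> n \<in> vecs a \<and> (\<Sum>i<a. n i) = 0"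
  by (simp add: zero_sum_vecs_def vecs_def dotp_def ones_def)

lemma qexponent_eq_weight:
  assumes "n \<in> zero_sum_vecs a"
  shows "qexponent a n = weight a n"
proof -
  have "(\<Sum>i<a. n i) = 0"
    using assms by (simp add: zero_sum_vecs_iff)
  moreover have "(\<Sum>i<a. 2 * tri (n i)) = (\<Sum>i<a. n i * n i) - (\<Sum>i<a. n i)"
    unfolding two_tri by (simp add: algebra_simps sum_subtractf)
  ultimately have "dotp a n n = 2 * (\<Sum>i<a. tri (n i))"
    by (simp add: dotp_def sum_distrib_left)
  then have "(int a * dotp a n n) div 2 = int a * (\<Sum>i<a. tri (n i))"
    by simp
  then show ?thesis
    by (simp add: qexponent_def weight_def sum.distrib sum_distrib_left dotp_def bvec_def)
qed

lemma weight_term_eq_prod: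
  fixes q :: complex
  assumes "q \<noteq> 0"
  shows "q powi weight a n * (\<Prod>i<a. w i powi n i) =
    (\<Prod>i<a. (q ^ a) powi tri (n i) * (q ^ i * w i) powi n i)"
proof -
  have "q powi (int a * tri (n i) + int i * n i) * w i powi n i =
      (q ^ a) powi tri (n i) * (q ^ i * w i) powi n i" for i
    using assms by (simp add: power_int_add power_int_mult power_int_mult_distrib)
  then show ?thesis
    unfolding weight_def power_int_sum[OF assms] prod.distrib[symmetric] by simp
qed

lemma
  fixes q :: complex
  assumes a: "a > 0" and q: "q \<noteq> 0" "norm q < 1" and w: "\<And>i. i < a \<Longrightarrow> w i \<noteq> 0"
  shows summable_weight_term: "(\<lambda>n. q powi weight a n * (\<Prod>i<a. w i powi n i)) summable_on vecs a"
    and infsum_weight_term: "(\<Sum>\<^sub>\<infinity>n\<in>vecs a. q powi weight a n * (\<Prod>i<a. w i powi n i)) =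
      (\<Prod>i<a. theta (q ^ a) (q ^ i * w i))"
proof -
  have qa: "q ^ a \<noteq> 0" "norm (q ^ a) < 1"
    using a q by (auto simp: norm_power power_less_one_iff)
  have s: "(\<lambda>k. norm ((q ^ a) powi tri k * (q ^ i * w i) powi k)) summable_on UNIV" if "i \<in> {..<a}" for i
    by (rule theta_term_abs_summable[OF qa]) (use q w that in auto)
  have "(\<lambda>n. norm (\<Prod>i<a. (q ^ a) powi tri (n i) * (q ^ i * w i) powi n i)) summable_on vecs a"
    unfolding vecs_def prod_norm[symmetric]
    by (rule summable_prod_PiE_nonneg[OF finite_lessThan s]) auto
  then show "(\<lambda>n. q powi weight a n * (\<Prod>i<a. w i powi n i)) summable_on vecs a"
    unfolding weight_term_eq_prod[OF q(1)] by (rule abs_summable_summable)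
  show "(\<Sum>\<^sub>\<infinity>n\<in>vecs a. q powi weight a n * (\<Prod>i<a. w i powi n i)) =
      (\<Prod>i<a. theta (q ^ a) (q ^ i * w i))"
    unfolding weight_term_eq_prod[OF q(1)] vecs_def theta_def
    by (rule infsum_prod_PiE_abs[OF finite_lessThan s])
qed

text \<open>
  These move all beads \<open>a n\<^sub>i + i\<close> of a configuration up or down by one: the bead in residue class
  \<open>a - 1\<close> moves up into residue class \<open>0\<close>, and its quotient by \<open>a\<close> increases.
\<close>

definition up :: "nat \<Rightarrow> (nat \<Rightarrow> int) \<Rightarrow> nat \<Rightarrow> int" where
  "up a n = (\<lambda>i\<in>{..<a}. if i = 0 then n (a - 1) + 1 else n (i - 1))"

definition down :: "nat \<Rightarrow> (nat \<Rightarrow> int) \<Rightarrow> nat \<Rightarrow> int" where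
  "down a n = (\<lambda>i\<in>{..<a}. if i = a - 1 then n 0 - 1 else n (i + 1))"

lemma up_in_vecs [simp]: "up a n \<in> vecs a" and down_in_vecs [simp]: "down a n \<in> vecs a"
  by (simp_all add: up_def down_def vecs_def)

lemma vecs_eqI:
  assumes "n \<in> vecs a" "n' \<in> vecs a" "\<And>i. i < a \<Longrightarrow> n i = n' i"
  shows "n = n'"
  using assms unfolding vecs_def by (intro PiE_ext) auto

lemma up_down: "n \<in> vecs a \<Longrightarrow> up a (down a n) = n"
  by (rule vecs_eqI[OF up_in_vecs]) (auto simp: up_def down_def)

lemma down_up: "n \<in> vecs a \<Longrightarrow> down a (up a n) = n"
  by (rule vecs_eqI[OF down_in_vecs]) (auto simp: up_def down_def)

lemma sum_up:
  assumes "a > 0"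
  shows "(\<Sum>i<a. up a n i) = (\<Sum>i<a. n i) + 1"
proof -
  obtain b where [simp]: "a = Suc b" using assms gr0_conv_Suc by blast
  have "(\<Sum>i<a. up a n i) = (n b + 1) + (\<Sum>i<b. n i)"
    by (simp add: sum.lessThan_Suc_shift up_def del: sum.lessThan_Suc)
  then show ?thesis by simp
qed

lemma weight_up:
  assumes "a > 0"
  shows "weight a (up a n) = weight a n + (\<Sum>i<a. n i)"
proof -
  obtain b where [simp]: "a = Suc b" using assms gr0_conv_Suc by blast
  have "weight a (up a n) = int a * tri (n b + 1) + (\<Sum>i<b. int a * tri (n i) + int (Suc i) * n i)"
    unfolding weight_def by (simp add: sum.lessThan_Suc_shift up_def del: sum.lessThan_Suc)
  also have "\<dots> = weight a n + (\<Sum>i<a. n i)"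
    unfolding weight_def tri_add_one by (simp add: algebra_simps sum.distrib)
  finally show ?thesis .
qed

lemma sum_down: "a > 0 \<Longrightarrow> n \<in> vecs a \<Longrightarrow> (\<Sum>i<a. down a n i) = (\<Sum>i<a. n i) - 1"
  using sum_up[of a "down a n"] by (simp add: up_down)

lemma weight_down: "a > 0 \<Longrightarrow> n \<in> vecs a \<Longrightarrow> weight a (down a n) = weight a n - (\<Sum>i<a. n i) + 1"
  using weight_up[of a "down a n"] by (simp add: up_down sum_down)

text \<open>
  Let \<open>U k\<close> collect the vectors with coordinate sum \<open>k\<close>. The cyclic shift \<open>up\<close> gives
  \<open>U (k + 1) = q powi k * U k\<close>, so the sum over all vectors is \<open>U 0 * theta q 1\<close>. The same sum
  factors over the coordinates into the product that \<open>prod_theta_residues\<close> evaluates, and the nonzero factor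
  \<open>theta q 1\<close> cancels.
\<close>

lemma core_generating_function:
  fixes q :: complex
  assumes a: "a > 0" and q: "q \<noteq> 0" "norm q < 1"
  shows "(\<Sum>\<^sub>\<infinity>n\<in>zero_sum_vecs a. q powi weight a n) = E (q ^ a) ^ a / E q"
proof -
  define V where "V k = {n \<in> vecs a. (\<Sum>i<a. n i) = k}" for k
  define U where "U k = (\<Sum>\<^sub>\<infinity>n\<in>V k. q powi weight a n)" for k
  have sum: "(\<lambda>n. q powi weight a n) summable_on vecs a"
    using summable_weight_term[OF a q, of "\<lambda>_. 1"] by simp
  have total: "(\<Sum>\<^sub>\<infinity>n\<in>vecs a. q powi weight a n) = E (q ^ a) ^ a / E q * theta q 1"
    using infsum_weight_term[OF a q, of "\<lambda>_. 1"] prod_theta_residues[OF a q] by simp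
  have bij: "bij_betw snd (Sigma UNIV V) (vecs a)"
    by (rule bij_betwI[of _ _ _ "\<lambda>n. (\<Sum>i<a. n i, n)"]) (auto simp: V_def)
  have "((\<lambda>p. q powi weight a (snd p)) has_sum (E (q ^ a) ^ a / E q * theta q 1)) (Sigma UNIV V)"
    unfolding has_sum_reindex_bij_betw[OF bij, of "\<lambda>n. q powi weight a n"]
    using sum total by (metis has_sum_infsum)
  then have "(U has_sum (E (q ^ a) ^ a / E q * theta q 1)) UNIV"
  proof (rule has_sum_SigmaD)
    fix k
    have "(\<lambda>n. q powi weight a n) summable_on V k"
      by (rule summable_on_subset_banach[OF sum]) (auto simp: V_def)
    then show "((\<lambda>y. q powi weight a (snd (k, y))) has_sum U k) (V k)"
      by (simp add: U_def)
  qed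
  then have U_sum: "((\<lambda>k. U k * 1 powi k) has_sum (E (q ^ a) ^ a / E q * theta q 1)) UNIV"
    by simp
  have U_Suc: "U (k + int 1) = 1 * q powi k * U k" for k
  proof -
    have "U (k + 1) = (\<Sum>\<^sub>\<infinity>n\<in>V k. q powi k * q powi weight a n)"
      unfolding U_def
      by (rule infsum_reindex_bij_witness[of _ "up a" "down a"])
        (use a q in \<open>auto simp: V_def up_down down_up sum_up sum_down weight_down power_int_add[symmetric]\<close>)
    then show ?thesis
      by (simp add: U_def infsum_cmult_right')
  qed
  have "E (q ^ a) ^ a / E q * theta q 1 = U 0 * theta q 1"
    using quasiperiodic_laurent_series[OF q _ _ _ U_Suc U_sum] by simp
  moreover have "theta q 1 \<noteq> 0"
  proof (rule theta_nonzero[OF q])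
    fix m :: int
    show "1 \<noteq> - (q powi m)"
    proof
      assume *: "1 = - (q powi m)"
      then have "norm q powi m = norm q powi 0"
        by (metis norm_minus_cancel norm_one norm_power_int power_int_0_right)
      then have "m = 0" by (rule power_int_inj[OF q])
      with * show False by simp
    qed
  qed simp
  ultimately have "U 0 = E (q ^ a) ^ a / E q" by (metis mult_right_cancel)
  moreover have "V 0 = zero_sum_vecs a"
    by (auto simp: V_def zero_sum_vecs_iff)
  ultimately show ?thesis by (simp add: U_def)
qed

section \<open>The series with a marked bead\<close>

lemma shift_coord_in_vecs: "n \<in> vecs a \<Longrightarrow> i < a \<Longrightarrow> n(i := c) \<in> vecs a"
  by (auto simp: vecs_def PiE_iff extensional_def)

lemma sum_shift_coord:
  fixes a i :: nat
  assumes "i < a"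
  shows "(\<Sum>j<a. (n(i := n i + c)) j) = (\<Sum>j<a. n j) + (c :: int)"
proof -
  have "(\<Sum>j<a. (n(i := n i + c)) j) = (\<Sum>j<a. n j + (if j = i then c else 0))"
    by (intro sum.cong) auto
  then show ?thesis using assms by (simp add: sum.distrib)
qed

lemma weight_shift_coord:
  assumes "i < a"
  shows "weight a (n(i := n i + 1)) = weight a n + int a * n i + int i"
proof -
  have "weight a (n(i := n i + 1)) =
      (\<Sum>j<a. int a * tri (n j) + int j * n j + (if j = i then int a * n i + int i else 0))"
    unfolding weight_def by (intro sum.cong) (auto simp: tri_add_one distrib_left)
  then show ?thesis using assms by (simp add: sum.distrib weight_def)
qed

text \<open>The zero-sum configurations that have a bead at position \<open>k\<close>.\<close>

definition bead_vecs :: "nat \<Rightarrow> int \<Rightarrow> (nat \<Rightarrow> int) set" where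
  "bead_vecs a k = {n \<in> zero_sum_vecs a. n (nat (k mod int a)) = k div int a}"

definition crank_coeff :: "nat \<Rightarrow> complex \<Rightarrow> int \<Rightarrow> complex" where
  "crank_coeff a q k = (\<Sum>\<^sub>\<infinity>n\<in>bead_vecs a k. q powi weight a n)"

definition crank_sum :: "nat \<Rightarrow> complex \<Rightarrow> complex \<Rightarrow> complex" where
  "crank_sum a q z =
     (\<Sum>\<^sub>\<infinity>n\<in>zero_sum_vecs a. q powi weight a n * (\<Sum>j<a. z powi (int a * n j + int j)))"

lemma bead_down:
  assumes "a > 0"
  shows "down a n (nat ((k - 1) mod int a)) = (k - 1) div int a \<longleftrightarrow> n (nat (k mod int a)) = k div int a"
proof -
  define u r where "u = (k - 1) div int a" and "r = (k - 1) mod int a"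
  have r: "0 \<le> r" "r < int a" using assms by (auto simp: r_def)
  have k: "k = int a * u + (r + 1)"
    using div_mult_mod_eq[of "k - 1" "int a"] by (simp add: u_def r_def algebra_simps)
  show ?thesis
  proof (cases "r = int a - 1")
    case True
    then have "k = int a * (u + 1)" using k by (simp add: algebra_simps)
    then have "k mod int a = 0" "k div int a = u + 1" using assms by auto
    moreover have "nat r = a - 1" using True by auto
    ultimately show ?thesis using assms
      by (auto simp: down_def simp flip: u_def r_def)
  next
    case False
    then have r': "0 \<le> r + 1" "r + 1 < int a" using r by auto
    then have "k mod int a = r + 1" "k div int a = u" unfolding k by auto
    moreover have "nat r \<noteq> a - 1" "nat r < a" "nat (r + 1) = nat r + 1" using r' r by auto
    ultimately show ?thesis by (auto simp: down_def simp flip: u_def r_def)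
  qed
qed

text \<open>
  The bijection moves all beads down by one and then the marked bead up by \<open>a\<close>. On a zero-sum vector
  the first move adds \<open>1\<close> to the weight. The second raises the coordinate of residue \<open>i\<close> from \<open>u\<close>
  to \<open>u + 1\<close>, where \<open>a u + i = k - 1\<close>, and adds \<open>k - 1\<close> to the weight.
\<close>

lemma crank_coeff_shift:
  assumes a: "a > 0" and q: "q \<noteq> 0"
  shows "crank_coeff a q (k + int (a - 1)) = q powi k * crank_coeff a q k"
proof -
  define i where "i = nat ((k - 1) mod int a)"
  define u where "u = (k - 1) div int a"
  have i: "i < a" using a by (simp add: i_def nat_less_iff)
  have k: "int a * u + int i = k - 1"
    using a by (simp add: i_def u_def)
  have k': "k + int (a - 1) = int i + (u + 1) * int a"
    using k a by (simp add: of_nat_diff algebra_simps)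
  have kmod: "(k + int (a - 1)) mod int a = int i"
    unfolding k' using i by simp
  have kdiv: "(k + int (a - 1)) div int a = u + 1"
    unfolding k' using i by simp
  let ?f = "\<lambda>n. (down a n)(i := down a n i + 1)" and ?g = "\<lambda>m. up a (m(i := m i + - 1))"
  have beads: "n \<in> bead_vecs a k \<longleftrightarrow> n \<in> vecs a \<and> (\<Sum>i<a. n i) = 0 \<and> down a n i = u" for n
    using bead_down[OF a, of n k] by (auto simp: bead_vecs_def zero_sum_vecs_iff i_def u_def)
  have beads': "n \<in> bead_vecs a (k + int (a - 1)) \<longleftrightarrow> n \<in> vecs a \<and> (\<Sum>i<a. n i) = 0 \<and> n i = u + 1" for n
    unfolding bead_vecs_def kmod kdiv by (auto simp: zero_sum_vecs_iff)
  have "crank_coeff a q (k + int (a - 1)) = (\<Sum>\<^sub>\<infinity>n\<in>bead_vecs a k. q powi k * q powi weight a n)"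
    unfolding crank_coeff_def
  proof (rule infsum_reindex_bij_witness[of _ ?f ?g])
    fix m assume "m \<in> bead_vecs a (k + int (a - 1))"
    then have m: "m \<in> vecs a" "(\<Sum>i<a. m i) = 0" "m i = u + 1"
      unfolding beads' by simp_all
    have m': "m(i := m i + - 1) \<in> vecs a" using shift_coord_in_vecs[OF m(1) i] .
    have d: "down a (?g m) = m(i := m i + - 1)" by (rule down_up[OF m'])
    have m_upd: "m(i := u + 1) = m" using m(3) by (simp add: fun_upd_idem)
    show "?f (?g m) = m" unfolding d by simp
    have s: "(\<Sum>j<a. (m(i := m i + - 1)) j) = - 1"
      using sum_shift_coord[OF i, of m "- 1"] m by simp
    show "?g m \<in> bead_vecs a k"
      unfolding beads d using sum_up[OF a, of "m(i := m i + - 1)"] s m(3) by simp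
    have "weight a m = weight a (m(i := m i + - 1)) + int a * u + int i"
      using weight_shift_coord[OF i, of "m(i := m i + - 1)"] m(3) by (simp add: m_upd)
    moreover have "weight a (?g m) = weight a (m(i := m i + - 1)) - 1"
      using weight_up[OF a, of "m(i := m i + - 1)"] s by simp
    ultimately have "weight a m = k + weight a (?g m)" using k by simp
    then show "q powi k * q powi weight a (?g m) = q powi weight a m"
      using q by (simp add: power_int_add)
  next
    fix n assume "n \<in> bead_vecs a k"
    then have n: "n \<in> vecs a" "(\<Sum>i<a. n i) = 0" "down a n i = u"
      by (simp_all add: beads)
    have "(?f n)(i := ?f n i + - 1) = down a n" by (simp add: fun_upd_idem)
    then show "?g (?f n) = n" using up_down[OF n(1)] by simp
    show "?f n \<in> bead_vecs a (k + int (a - 1))"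
      unfolding beads' using shift_coord_in_vecs[OF down_in_vecs i, of n "down a n i + 1"]
        sum_shift_coord[OF i, of "down a n" 1] sum_down[OF a n(1)] n(2,3) by simp
  qed
  then show ?thesis
    by (simp add: crank_coeff_def infsum_cmult_right')
qed

lemma crank_term_summable:
  fixes q z :: complex
  assumes a: "a > 0" and q: "q \<noteq> 0" "norm q < 1" and z: "z \<noteq> 0" and j: "j < a"
  shows "(\<lambda>n. q powi weight a n * z powi (int a * n j + int j)) summable_on zero_sum_vecs a"
proof -
  \<comment> \<open>The marked coordinate only rescales the argument of one theta factor.\<close>
  let ?w = "\<lambda>i. if i = j then z ^ a else 1"
  have "(\<Prod>i<a. ?w i powi n i) = z powi (int a * n j)" for n :: "nat \<Rightarrow> int"
  proof -
    have "(\<Prod>i<a. ?w i powi n i) = (\<Prod>i<a. if i = j then z powi (int a * n j) else 1)"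
      by (intro prod.cong) (auto simp: power_int_mult)
    then show ?thesis using j by simp
  qed
  then have "(\<lambda>n. q powi weight a n * z powi (int a * n j)) summable_on vecs a"
    using summable_weight_term[OF a q, of ?w] z by simp
  then have "(\<lambda>n. q powi weight a n * z powi (int a * n j)) summable_on zero_sum_vecs a"
    by (rule summable_on_subset_banach) (auto simp: zero_sum_vecs_iff)
  from summable_on_cmult_left[OF this, of "z powi int j"] show ?thesis
    using z by (simp add: power_int_add mult_ac)
qed

text \<open>
  Both series are rearrangements of one absolutely convergent sum over pairs of a residue \<open>j\<close> and
  a vector \<open>n\<close>; the Laurent series groups the pairs by the position \<open>a n\<^sub>j + j\<close> of the marked bead.
\<close>

lemma
  fixes q z :: complex
  assumes a: "a > 0" and q: "q \<noteq> 0" "norm q < 1" and z: "z \<noteq> 0"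
  shows crank_laurent_series: "((\<lambda>k. crank_coeff a q k * z powi k) has_sum crank_sum a q z) UNIV"
    and crank_sum_has_sum: "((\<lambda>n. q powi weight a n * (\<Sum>j<a. z powi (int a * n j + int j)))
          has_sum crank_sum a q z) (zero_sum_vecs a)"
proof -
  let ?Z = "zero_sum_vecs a"
  let ?h = "\<lambda>(j, n). q powi weight a n * z powi (int a * n j + int j)"
  have "(\<lambda>p. norm (?h p)) summable_on {..<a} \<times> ?Z"
    using crank_term_summable[OF a q z]
    by (intro Infinite_Sum.abs_summable_on_Sigma_iff[THEN iffD2] conjI ballI)
      (auto simp: summable_on_iff_abs_summable_on_complex)
  then have sum: "?h summable_on {..<a} \<times> ?Z" by (rule abs_summable_summable)
  then obtain S where S: "(?h has_sum S) ({..<a} \<times> ?Z)"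
    by (auto simp: summable_on_def)
  then have "((\<lambda>(n, j). ?h (j, n)) has_sum S) (?Z \<times> {..<a})"
    by (subst (asm) has_sum_swap) simp
  then have Z: "((\<lambda>n. q powi weight a n * (\<Sum>j<a. z powi (int a * n j + int j))) has_sum S) ?Z"
    by (rule has_sum_SigmaD) (auto intro!: has_sum_finiteI simp: sum_distrib_left)
  then have S_eq: "crank_sum a q z = S"
    unfolding crank_sum_def by (rule infsumI)
  show "((\<lambda>n. q powi weight a n * (\<Sum>j<a. z powi (int a * n j + int j)))
          has_sum crank_sum a q z) (zero_sum_vecs a)"
    unfolding S_eq by (rule Z)
  have bij: "bij_betw (\<lambda>(k, n). (nat (k mod int a), n)) (Sigma UNIV (bead_vecs a)) ({..<a} \<times> ?Z)"
    by (rule bij_betwI[of _ _ _ "\<lambda>(j, n). (int a * n j + int j, n)"])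
      (use a in \<open>auto simp: bead_vecs_def nat_less_iff\<close>)
  have "((\<lambda>(k, n). q powi weight a n * z powi k) has_sum S) (Sigma UNIV (bead_vecs a))"
  proof (rule has_sum_cong[THEN iffD1])
    show "((\<lambda>p. ?h (case p of (k, n) \<Rightarrow> (nat (k mod int a), n))) has_sum S) (Sigma UNIV (bead_vecs a))"
      using has_sum_reindex_bij_betw[OF bij] S by blast
    fix p assume "p \<in> Sigma UNIV (bead_vecs a)"
    then show "?h (case p of (k, n) \<Rightarrow> (nat (k mod int a), n)) = (case p of (k, n) \<Rightarrow> q powi weight a n * z powi k)"
      using a by (auto simp: bead_vecs_def)
  qed
  then have "((\<lambda>k. crank_coeff a q k * z powi k) has_sum S) UNIV"
  proof (rule has_sum_SigmaD)
    fix k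
    have "(\<lambda>n. q powi weight a n) summable_on vecs a"
      using summable_weight_term[OF a q, of "\<lambda>_. 1"] by simp
    then have "(\<lambda>n. q powi weight a n) summable_on bead_vecs a k"
      by (rule summable_on_subset_banach) (auto simp: bead_vecs_def zero_sum_vecs_iff)
    then show "((\<lambda>n. case (k, n) of (k, n) \<Rightarrow> q powi weight a n * z powi k) has_sum
        crank_coeff a q k * z powi k) (bead_vecs a k)"
      by (auto simp: crank_coeff_def intro!: has_sum_cmult_left)
  qed
  then show "((\<lambda>k. crank_coeff a q k * z powi k) has_sum crank_sum a q z) UNIV"
    unfolding S_eq .
qed

definition reflect :: "nat \<Rightarrow> (nat \<Rightarrow> int) \<Rightarrow> nat \<Rightarrow> int" where
  "reflect a n = (\<lambda>i\<in>{..<a}. - n (a - Suc i))"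

lemma sum_reflect: "(\<Sum>i<a. reflect a n i) = - (\<Sum>i<a. n i)"
proof -
  have "(\<Sum>i<a. reflect a n i) = (\<Sum>i<a. - n (a - Suc i))"
    by (intro sum.cong) (auto simp: reflect_def)
  also have "\<dots> = (\<Sum>i<a. - n i)" by (rule sum.nat_diff_reindex)
  finally show ?thesis by (simp add: sum_negf)
qed

lemma weight_reflect: "weight a (reflect a n) = weight a n + (\<Sum>i<a. n i)"
proof -
  \<comment> \<open>The factor \<open>int i\<close> is written as a function of \<open>a - Suc i\<close> so that the whole summand can be reindexed.\<close>
  have "weight a (reflect a n) =
      (\<Sum>i<a. int a * tri (- n (a - Suc i)) + (int a - 1 - int (a - Suc i)) * (- n (a - Suc i)))"
    unfolding weight_def by (intro sum.cong) (auto simp: reflect_def of_nat_diff)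
  also have "\<dots> = (\<Sum>i<a. int a * tri (- n i) + (int a - 1 - int i) * (- n i))"
    by (rule sum.nat_diff_reindex)
  also have "\<dots> = (\<Sum>i<a. (int a * tri (n i) + int i * n i) + n i)"
    unfolding tri_minus by (intro sum.cong) (auto simp: algebra_simps)
  finally show ?thesis by (simp add: weight_def sum.distrib)
qed

lemma reflect_zero_sum_vecs:
  assumes "n \<in> zero_sum_vecs a"
  shows "reflect a n \<in> zero_sum_vecs a" "reflect a (reflect a n) = n" 
    "weight a (reflect a n) = weight a n"
proof -
  have n: "n \<in> vecs a" "(\<Sum>i<a. n i) = 0"
    using assms by (simp_all add: zero_sum_vecs_iff)
  have r: "reflect a n \<in> vecs a" for n by (simp add: reflect_def vecs_def)
  show "reflect a n \<in> zero_sum_vecs a" "weight a (reflect a n) = weight a n"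
    using n r by (simp_all add: zero_sum_vecs_iff sum_reflect weight_reflect)
  show "reflect a (reflect a n) = n"
    by (rule vecs_eqI[OF r n(1)]) (auto simp: reflect_def)
qed

text \<open>
  The exceptional term \<open>z powi (- a n\<^bsub>a-1\<^esub>)\<close> has, by reflection, the same sum as the term
  \<open>z powi (a n\<^sub>0)\<close> with \<open>j = 0\<close> that \<open>crank_sum\<close> has in its place.
\<close>

lemma summand_has_sum:
  fixes q z :: complex
  assumes a: "a > 0" and q: "q \<noteq> 0" "norm q < 1" and z: "z \<noteq> 0"
  shows "(summand a q z has_sum crank_sum a q z) (zero_sum_vecs a)"
proof -
  let ?Z = "zero_sum_vecs a"
  let ?h = "\<lambda>j n. q powi weight a n * z powi (int a * n j + int j)"
  let ?r = "\<lambda>n. q powi weight a n * z powi (- (int a * n (a - 1)))"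
  obtain b where [simp]: "a = Suc b" using a gr0_conv_Suc by blast
  have "(?h 0 has_sum infsum (?h 0) ?Z) ?Z"
    using crank_term_summable[OF a q z, of 0] by simp
  moreover have "(?h 0 has_sum infsum (?h 0) ?Z) ?Z \<longleftrightarrow> (?r has_sum infsum (?h 0) ?Z) ?Z"
  proof (rule has_sum_reindex_bij_witness[of _ "reflect a" "reflect a"])
    fix n assume n: "n \<in> ?Z"
    have "reflect a n (a - 1) = - n 0" by (simp add: reflect_def)
    then show "?r (reflect a n) = ?h 0 n"
      unfolding reflect_zero_sum_vecs(3)[OF n] by simp
  qed (use reflect_zero_sum_vecs in auto)
  ultimately have "((\<lambda>n. ?r n + - ?h 0 n) has_sum (infsum (?h 0) ?Z + - infsum (?h 0) ?Z)) ?Z"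
    by (intro has_sum_add has_sum_uminusI) auto
  from has_sum_add[OF crank_sum_has_sum[OF assms] this]
  have "((\<lambda>n. q powi weight a n * (\<Sum>j<a. z powi (int a * n j + int j)) + (?r n - ?h 0 n))
      has_sum crank_sum a q z) ?Z"
    by simp
  then show ?thesis
  proof (rule has_sum_cong[THEN iffD1, rotated])
    fix n assume n: "n \<in> ?Z"
    have "(\<Sum>j<a. z powi (int a * n j + int j)) =
        z powi (int a * n 0) + (\<Sum>j = 1..a - 1. z powi (int a * n j + int j))"
      by (simp add: lessThan_Suc_atMost atMost_atLeast0 sum.atLeast_Suc_atMost del: sum.lessThan_Suc)
    then show "q powi weight a n * (\<Sum>j<a. z powi (int a * n j + int j)) + (?r n - ?h 0 n) = summand a q z n"
      unfolding summand_def qexponent_eq_weight[OF n] by (simp add: algebra_simps)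
  qed
qed

lemma polynomial_vanishing_on_roots_of_unity:
  fixes e :: "nat \<Rightarrow> complex"
  assumes a: "a > 0" and zero: "\<And>z. z ^ a = 1 \<Longrightarrow> (\<Sum>r<a. e r * z ^ r) = 0" and r: "r < a"
  shows "e r = 0"
proof (rule ccontr)
  assume "e r \<noteq> 0"
  moreover have "r \<le> a - 1" using r by simp
  ultimately have *: "finite {z. (\<Sum>i\<le>a - 1. e i * z ^ i) = 0}"
      "card {z. (\<Sum>i\<le>a - 1. e i * z ^ i) = 0} \<le> a - 1"
    using polyfun_roots_finite[of e r "a - 1"] polyfun_roots_card[of e r "a - 1"] by auto
  have "{..a - 1} = {..<a}" using a by auto
  then have "{z. z ^ a = 1} \<subseteq> {z. (\<Sum>i\<le>a - 1. e i * z ^ i) = 0}"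
    using zero by auto
  then have "card {z :: complex. z ^ a = 1} \<le> a - 1"
    using card_mono[OF *(1)] *(2) by (meson order_trans)
  then show False
    using card_roots_unity_eq[OF a] a by simp
qed

section \<open>Identification with a theta quotient\<close>

lemma crank_sum_root_of_unity:
  assumes "a > 0" "z ^ a = 1" "z \<noteq> 1"
  shows "crank_sum a q z = 0"
proof -
  have z: "z \<noteq> 0" using assms by (auto simp: power_0_left)
  have "(\<Sum>j<a. z powi (int a * m j + int j)) = 0" for m :: "nat \<Rightarrow> int"
  proof -
    have "z powi (int a * m j + int j) = z ^ j" for j
      using z assms(2) by (simp add: power_int_add power_int_mult)
    then show ?thesis
      using assms by (simp add: sum_gp_strict)
  qed
  then show ?thesis by (simp add: crank_sum_def)
qed

text \<open>
  The coefficients of the left-hand side inherit a recurrence of step \<open>a\<close>: step \<open>a - 1\<close> from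
  \<open>crank_sum\<close> and step \<open>1\<close> from \<open>theta\<close>. This reduces the product to \<open>a\<close> unknown constants, and its
  \<open>a\<close> zeros at the roots of unity eliminate all of them but \<open>D\<close>.
\<close>

lemma crank_sum_times_theta:
  fixes q :: complex
  assumes a: "a > 0" and q: "q \<noteq> 0" "norm q < 1"
  obtains D where "\<And>z. z \<noteq> 0 \<Longrightarrow> crank_sum a q z * theta q (- z) = D * theta (q ^ a) (- (z ^ a))"
proof -
  have qa: "q ^ a \<noteq> 0" "norm (q ^ a) < 1"
    using a q by (auto simp: norm_power power_less_one_iff)
  define t where "t k = q powi tri k * (- 1) powi k" for k
  define d where "d m = (\<Sum>\<^sub>\<infinity>k. crank_coeff a q k * t (m - k))" for m
  have t: "((\<lambda>k. t k * z powi k) has_sum theta q (- z)) UNIV" if "z \<noteq> 0" for z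
  proof -
    have "t k * z powi k = q powi tri k * (- z) powi k" for k
      using power_int_mult_distrib[of "- 1" z k] by (simp add: t_def)
    then show ?thesis using theta_has_sum[OF q, of "- z"] that by simp
  qed
  have t_Suc: "t (k + 1) = - (q powi k) * t k" for k
    using theta_term_Suc[OF q(1), of "- 1" k] by (simp add: t_def)
  have d: "d (m + int a) = - 1 * q powi m * d m" for m
  proof -
    have "d (m + int a) = (\<Sum>\<^sub>\<infinity>k. - (q powi m) * (crank_coeff a q k * t (m - k)))"
      unfolding d_def
    \<comment> \<open>Of the total step \<open>a\<close>, move \<open>a - 1\<close> into the index of \<open>crank_coeff\<close> and \<open>1\<close> into that of \<open>t\<close>.\<close>
    proof (rule infsum_reindex_bij_witness[of _ "\<lambda>k. k + int (a - 1)" "\<lambda>k. k - int (a - 1)"])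
      fix k
      define l where "l = k - int (a - 1)"
      have k: "k = l + int (a - 1)" by (simp add: l_def)
      have e: "m + int a - k = (m - l) + 1" using a by (simp add: k of_nat_diff)
      have t': "t (m + int a - k) = - (q powi (m - l)) * t (m - l)"
        unfolding e by (rule t_Suc)
      have c': "crank_coeff a q k = q powi l * crank_coeff a q l"
        unfolding k by (rule crank_coeff_shift[OF a q(1)])
      have "q powi m = q powi l * q powi (m - l)" using q by (simp flip: power_int_add)
      then have "crank_coeff a q k * t (m + int a - k) = 
          - (q powi m) * (crank_coeff a q l * t (m - l))"
        unfolding t' c' by simp
      then show "- (q powi m) * (crank_coeff a q (k - int (a - 1)) * t (m - (k - int (a - 1)))) = 
          crank_coeff a q k * t (m + int a - k)"
        by (simp add: l_def)
    qed auto
    also have "\<dots> = - (q powi m) * d m"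
      unfolding d_def by (rule infsum_cmult_right')
    finally show ?thesis by simp
  qed
  have expansion: "crank_sum a q z * theta q (- z) =
      (\<Sum>r<a. d (int r) * z ^ r * theta (q ^ a) (- (q ^ r * z ^ a)))" if "z \<noteq> 0" for z
    using quasiperiodic_laurent_series[OF q _ that a d, of "crank_sum a q z * theta q (- z)"]
      laurent_product[OF that crank_laurent_series[OF a q that] t[OF that]]
    by (simp add: d_def)
  \<comment> \<open>On \<open>z ^ a = 1\<close> the expansion is a polynomial in \<open>z\<close>, because \<open>z\<close> enters its theta factors only as \<open>z ^ a\<close>.\<close>
  have zero: "d (int r) = 0" if r: "0 < r" "r < a" for r
  proof -
    have "d (int r) * theta (q ^ a) (- (q ^ r)) = 0"
    proof (rule polynomial_vanishing_on_roots_of_unity[OF a _ r(2)])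
      fix z :: complex assume z: "z ^ a = 1"
      then have "z \<noteq> 0" using a by (cases "z = 0") (auto simp: zero_power)
      moreover have "crank_sum a q z * theta q (- z) = 0"
        using crank_sum_root_of_unity[OF a z] theta_minus_one[OF q] by (cases "z = 1") auto
      ultimately have "(\<Sum>r<a. d (int r) * z ^ r * theta (q ^ a) (- (q ^ r * z ^ a))) = 0"
        using expansion[of z] by metis
      then show "(\<Sum>r<a. d (int r) * theta (q ^ a) (- (q ^ r)) * z ^ r) = 0"
        unfolding z by (simp add: mult_ac)
    qed
    moreover have "theta (q ^ a) (- (q ^ r)) \<noteq> 0"
    proof (rule theta_nonzero[OF qa])
      fix m :: int
      show "- (q ^ r) \<noteq> - ((q ^ a) powi m)"
      proof
        assume "- (q ^ r) = - ((q ^ a) powi m)"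
        then have "q powi int r = q powi (int a * m)"
          by (simp add: power_int_mult)
        then have "norm q powi int r = norm q powi (int a * m)"
          by (metis norm_power_int)
        then have "int r = int a * m" by (rule power_int_inj[OF q])
        then have "int r mod int a = 0" by simp
        with r show False by simp
      qed
    qed (use q in auto)
    ultimately show ?thesis by simp
  qed
  have "crank_sum a q z * theta q (- z) = d 0 * theta (q ^ a) (- (z ^ a))" if "z \<noteq> 0" for z
  proof -
    have "(\<Sum>r<a. d (int r) * z ^ r * theta (q ^ a) (- (q ^ r * z ^ a))) =
        (\<Sum>r<a. if r = 0 then d 0 * theta (q ^ a) (- (z ^ a)) else 0)"
      by (intro sum.cong) (auto simp: zero)
    then show ?thesis using expansion[OF that] a by simp
  qed
  then show ?thesis using that by blast
qed

section \<open>The infinite product\<close>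

lemma geom_quot_eq_sum: "geom_quot a w = (\<Sum>k<a. w ^ k)"
  by (simp add: geom_quot_def sum_gp_strict)

lemma geom_quot_mult: "(1 - w) * geom_quot a w = 1 - w ^ a"
  by (simp add: geom_quot_eq_sum sum_gp_strict)

lemma norm_geom_quot_minus_one:
  assumes "a > 0" "norm w \<le> R"
  shows "norm (geom_quot a w - 1) \<le> norm w * (\<Sum>k<a. R ^ k)"
proof -
  obtain b where a: "a = Suc b" using assms(1) gr0_conv_Suc by blast
  have "geom_quot a w - 1 = w * (\<Sum>k<b. w ^ k)"
    unfolding geom_quot_eq_sum a by (simp add: sum.lessThan_Suc_shift sum_distrib_left del: sum.lessThan_Suc)
  moreover have "norm (\<Sum>k<b. w ^ k) \<le> (\<Sum>k<b. R ^ k)"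
    using assms(2) by (intro sum_norm_le) (auto simp: norm_power intro!: power_mono)
  moreover have "(\<Sum>k<b. R ^ k) \<le> (\<Sum>k<a. R ^ k)"
    using a assms(2) norm_ge_zero[of w] by (intro sum_mono2) (auto intro!: zero_le_power simp del: norm_ge_zero)
  ultimately show ?thesis
    by (simp add: norm_mult mult_left_mono)
qed

lemma prod_factor_bound:
  fixes q :: complex
  assumes a: "a > 0" and q: "norm q < 1" and \<rho>: "\<rho> > 0"
  obtains K where "\<And>z n. norm z = \<rho> \<Longrightarrow> norm (prod_factor a q z (Suc n) - 1) \<le> K * norm q ^ n"
proof -
  \<comment> \<open>\<open>R\<close> bounds both \<open>norm z\<close> and \<open>norm (inverse z)\<close>, hence the arguments of both geometric sums.\<close>
  define R where "R = max \<rho> (1 / \<rho>)"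
  define G where "G = (\<Sum>k<a. R ^ k)"
  have R: "\<rho> \<le> R" "1 / \<rho> \<le> R" "0 \<le> R" using \<rho> by (auto simp: R_def)
  have G: "G \<ge> 0" using R by (auto simp: G_def intro!: sum_nonneg)
  have "norm (prod_factor a q z (Suc n) - 1) \<le> (R * G * (1 + R * G) + R * G) * norm q ^ n" if z: "norm z = \<rho>" for z n
  proof -
    define x y where "x = geom_quot a (z * q ^ n)" and "y = geom_quot a (inverse z * q ^ Suc n)"
    have p: "norm q ^ n \<le> 1" "norm q ^ Suc n \<le> norm q ^ n"
      using q by (auto intro!: power_le_one power_decreasing simp: mult_left_le_one_le)
    have nx: "norm (z * q ^ n) \<le> R * norm q ^ n"
      using z R by (auto simp: norm_mult norm_power intro!: mult_right_mono)
    have "norm (inverse z * q ^ Suc n) = 1 / \<rho> * norm q ^ Suc n"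
      using z by (simp add: norm_mult norm_power norm_inverse divide_inverse)
    also have "\<dots> \<le> R * norm q ^ n"
      using R p by (intro mult_mono) auto
    finally have ny: "norm (inverse z * q ^ Suc n) \<le> R * norm q ^ n" .
    have le: "R * norm q ^ n \<le> R"
      using p R by (simp add: mult_left_le)
    have x: "norm (x - 1) \<le> R * norm q ^ n * G"
      using norm_geom_quot_minus_one[OF a order_trans[OF nx le]] mult_right_mono[OF nx G]
      by (auto simp: x_def G_def)
    have y: "norm (y - 1) \<le> R * norm q ^ n * G"
      using norm_geom_quot_minus_one[OF a order_trans[OF ny le]] mult_right_mono[OF ny G]
      by (auto simp: y_def G_def)
    have "norm y \<le> 1 + norm (y - 1)"
      using norm_triangle_ineq[of 1 "y - 1"] by simp
    also have "\<dots> \<le> 1 + R * G"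
      using y mult_right_mono[OF le G] by simp
    finally have y': "norm y \<le> 1 + R * G" .
    have "x * y - 1 = (x - 1) * y + (y - 1)" by (simp add: algebra_simps)
    then have "norm (x * y - 1) \<le> norm (x - 1) * norm y + norm (y - 1)"
      by (metis norm_mult norm_triangle_ineq)
    also have "\<dots> \<le> (R * norm q ^ n * G) * (1 + R * G) + R * norm q ^ n * G"
      using x y y' R G by (intro add_mono mult_mono) auto
    finally show ?thesis
      by (simp add: prod_factor_def x_def y_def algebra_simps)
  qed
  then show ?thesis using that by blast
qed

lemma convergent_prod_factor:
  fixes q :: complex
  assumes a: "a > 0" and q: "norm q < 1" and z: "z \<noteq> 0"
  shows "convergent_prod (\<lambda>n. prod_factor a q z (Suc n))"
proof -
  obtain K where K: "\<And>z' n. norm z' = norm z \<Longrightarrow> norm (prod_factor a q z' (Suc n) - 1) \<le> K * norm q ^ n"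
    using prod_factor_bound[OF a q, of "norm z"] z by auto
  show ?thesis
  proof (rule convergent_prodI_norm, rule summable_comparison_test)
    show "summable (\<lambda>n. K * norm q ^ n)" using q by (simp add: summable_mult)
  qed (use K in auto)
qed

lemma continuous_on_prod_factor_prodinf:
  fixes q :: complex
  assumes a: "a > 0" and q: "norm q < 1" and \<rho>: "\<rho> > 0"
  shows "continuous_on (sphere 0 \<rho>) (\<lambda>z. \<Prod>n. prod_factor a q z (Suc n))"
proof -
  let ?f = "\<lambda>n z. prod_factor a q z (Suc n)"
  obtain K where K: "\<And>z n. norm z = \<rho> \<Longrightarrow> norm (?f n z - 1) \<le> K * norm q ^ n"
    using prod_factor_bound[OF a q \<rho>] by blast
  have cont: "continuous_on (sphere 0 \<rho>) (?f n)" for n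
    unfolding prod_factor_def geom_quot_eq_sum
    using \<rho> by (intro continuous_intros) auto
  have "uniformly_convergent_on (sphere 0 \<rho>) (\<lambda>N z. \<Sum>n<N. norm (?f n z - 1))"
    by (rule Weierstrass_m_test'[of _ _ "\<lambda>n. K * norm q ^ n"])
      (use K q in \<open>auto simp: summable_mult\<close>)
  then have "uniformly_convergent_on (sphere 0 \<rho>) (\<lambda>N z. \<Prod>n<N. ?f n z)"
    by (intro uniformly_convergent_on_prod' cont) auto
  then obtain g where g: "uniform_limit (sphere 0 \<rho>) (\<lambda>N z. \<Prod>n<N. ?f n z) g sequentially"
    by (auto simp: uniformly_convergent_on_def)
  have "continuous_on (sphere 0 \<rho>) g"
    by (rule uniform_limit_theorem[OF _ g]) (auto intro!: always_eventually continuous_on_prod cont)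
  moreover have "g z = (\<Prod>n. ?f n z)" if z: "z \<in> sphere 0 \<rho>" for z
  proof (rule LIMSEQ_unique)
    show "(\<lambda>N. \<Prod>n<N. ?f n z) \<longlonglongrightarrow> g z" by (rule tendsto_uniform_limitI[OF g z])
    show "(\<lambda>N. \<Prod>n<N. ?f n z) \<longlonglongrightarrow> (\<Prod>n. ?f n z)"
      using z \<rho> by (intro convergent_prod_LIMSEQ_lessThan convergent_prod_factor a q) auto
  qed
  ultimately show ?thesis
    by (simp cong: continuous_on_cong_simp)
qed

lemma continuous_on_crank_sum:
  fixes q :: complex
  assumes a: "a > 0" and q: "q \<noteq> 0" "norm q < 1" and \<rho>: "\<rho> > 0"
  shows "continuous_on (sphere 0 \<rho>) (crank_sum a q)"
proof -
  have "complex_of_real \<rho> \<noteq> 0" using \<rho> by simp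
  from has_sum_imp_summable[OF crank_laurent_series[OF a q this]]
  have M: "(\<lambda>k. norm (crank_coeff a q k) * \<rho> powi k) summable_on UNIV"
    using \<rho> by (simp add: summable_on_iff_abs_summable_on_complex norm_mult norm_power_int)
  have "uniform_limit (sphere 0 \<rho>) (\<lambda>X z. \<Sum>k\<in>X. crank_coeff a q k * z powi k) (crank_sum a q)
      (finite_subsets_at_top UNIV)"
    by (rule Weierstrass_m_test_general'[OF _ _ M])
      (use \<rho> in \<open>auto simp: norm_mult norm_power_int intro!: crank_laurent_series a q\<close>)
  then show ?thesis
  proof (rule uniform_limit_theorem[rotated])
    show "\<forall>\<^sub>F X in finite_subsets_at_top UNIV. continuous_on (sphere 0 \<rho>) (\<lambda>z. \<Sum>k\<in>X. crank_coeff a q k * z powi k)"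
      using \<rho> by (intro always_eventually allI continuous_intros) auto
  qed simp
qed

lemma prod_factor_times_theta:
  fixes q :: complex
  assumes a: "a > 0" and q: "q \<noteq> 0" "norm q < 1" and z: "z \<noteq> 0"
  shows "E (q ^ a) * ((\<Prod>n. prod_factor a q z (Suc n)) * theta q (- z)) = E q * theta (q ^ a) (- (z ^ a))"
proof -
  have qa: "q ^ a \<noteq> 0" "norm (q ^ a) < 1"
    using a q by (auto simp: norm_power power_less_one_iff)
  have "prod_factor a q z (Suc n) * ((1 + - z * q ^ n) * (1 + q ^ Suc n / - z)) =
      (1 + - (z ^ a) * (q ^ a) ^ n) * (1 + (q ^ a) ^ Suc n / - (z ^ a))" for n
  proof -
    have 1: "(1 + - z * q ^ n) * geom_quot a (z * q ^ n) = 1 + - (z ^ a) * (q ^ a) ^ n"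
      using geom_quot_mult[of "z * q ^ n" a]
      by (simp add: power_mult_distrib mult.commute flip: power_mult)
    have 2: "inverse z * q ^ Suc n = q ^ Suc n / z" by (simp add: field_simps)
    have 3: "(q ^ Suc n / z) ^ a = (q ^ a) ^ Suc n / z ^ a"
      by (simp only: power_divide power_mult[symmetric] mult.commute)
    have 4: "(1 + q ^ Suc n / - z) * geom_quot a (inverse z * q ^ Suc n) = 1 + (q ^ a) ^ Suc n / - (z ^ a)"
      using geom_quot_mult[of "q ^ Suc n / z" a] unfolding 2 3 by simp
    show ?thesis
      unfolding 1[symmetric] 4[symmetric] prod_factor_def by (simp add: mult_ac)
  qed
  then have "(\<Prod>n. prod_factor a q z (Suc n)) * theta_prod q (- z) = theta_prod (q ^ a) (- (z ^ a))"
    unfolding theta_prod_def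
    by (subst prodinf_mult[OF convergent_prod_factor[OF a q(2) z] convergent_theta_factors(3)[OF q(2)]])
      (simp only:)
  then show ?thesis
    using jacobi_triple_product[OF q, of "- z"] jacobi_triple_product[OF qa, of "- (z ^ a)"] z
    by (simp add: mult_ac)
qed

text \<open>
  Zeros of \<open>theta q (- w)\<close> are powers of \<open>q\<close>, which have pairwise different norms. So a zero \<open>z\<close> is the
  only one on its circle, and \<open>z\<close> is approached along the circle by nonzeros.
\<close>

lemma eq_on_sphere_of_theta_nonzero:
  fixes q :: complex and f g :: "complex \<Rightarrow> complex"
  assumes q: "q \<noteq> 0" "norm q < 1" and z: "z \<noteq> 0"
    and cont: "continuous_on (sphere 0 (norm z)) f" "continuous_on (sphere 0 (norm z)) g"
    and eq: "\<And>w. norm w = norm z \<Longrightarrow> theta q (- w) \<noteq> 0 \<Longrightarrow> f w = g w"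
  shows "f z = g z"
proof (cases "theta q (- z) = 0")
  case False
  then show ?thesis using eq by simp
next
  case True
  then obtain m where m: "z = q powi m"
    using theta_nonzero[OF q, of "- z"] z by auto
  define w where "w n = z * cis (1 / real (Suc n))" for n
  have w: "norm (w n) = norm z" for n by (simp add: w_def norm_mult)
  have "theta q (- w n) \<noteq> 0" for n
  proof (rule theta_nonzero[OF q])
    show "- w n \<noteq> 0" using w[of n] z by auto
    fix k :: int
    show "- w n \<noteq> - (q powi k)"
    proof
      assume *: "- w n = - (q powi k)"
      then have "norm q powi k = norm q powi m"
        using w[of n] m by (metis norm_minus_cancel norm_power_int)
      then have "k = m" by (rule power_int_inj[OF q])
      with * m have "w n = z" by simp
      then have "cis (1 / real (Suc n)) = 1" using z by (simp add: w_def)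
      then have "sin (1 / real (Suc n)) = 0" by (metis cis.sel(2) one_complex.sel(2))
      moreover have "0 < 1 / real (Suc n)" "1 / real (Suc n) < pi"
        using pi_gt3 by (auto simp: field_simps) (smt (verit) mult_nonneg_nonneg of_nat_0_le_iff)
      ultimately show False using sin_gt_zero[of "1 / real (Suc n)"] by linarith
    qed
  qed
  then have fg: "f (w n) = g (w n)" for n using eq w by blast
  have "(\<lambda>n. 1 / real (Suc n)) \<longlonglongrightarrow> 0"
    using LIMSEQ_inverse_real_of_nat by (simp add: inverse_eq_divide)
  then have "w \<longlonglongrightarrow> z * cis 0"
    unfolding w_def by (intro tendsto_mult tendsto_const tendsto_cis)
  then have lim: "w \<longlonglongrightarrow> z" by simp
  have "(\<lambda>n. f (w n)) \<longlonglongrightarrow> f z" "(\<lambda>n. g (w n)) \<longlonglongrightarrow> g z"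
    using w by (auto intro!: continuous_on_tendsto_compose[OF cont(1) lim]
        continuous_on_tendsto_compose[OF cont(2) lim])
  then show ?thesis using fg LIMSEQ_unique by simp
qed

text \<open>
  At \<open>z = 1\<close> the two families of factors are the quotients \<open>(1 - q ^ (a n)) / (1 - q ^ n)\<close> with
  \<open>n \<ge> 0\<close> and with \<open>n \<ge> 1\<close>; the only extra one is at \<open>n = 0\<close>, whose removable value is \<open>a\<close>.
\<close>

lemma prod_factor_at_one:
  fixes q :: complex
  assumes a: "a > 0" and q: "norm q < 1"
  shows "(\<Prod>n. prod_factor a q 1 (Suc n)) * E q ^ 2 = of_nat a * E (q ^ a) ^ 2"
proof -
  have qa: "norm (q ^ a) < 1"
    using a q by (auto simp: norm_power power_less_one_iff)
  let ?g = "\<lambda>n. geom_quot a (q ^ n)"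
  have g: "?g (Suc n) * (1 - q ^ Suc n) = 1 - (q ^ a) ^ Suc n" for n
    using geom_quot_mult[of "q ^ Suc n" a]
    by (simp only: mult.commute power_mult[symmetric])
  have g_eq: "?g (Suc n) = (1 - (q ^ a) ^ Suc n) / (1 - q ^ Suc n)" for n
    unfolding g[symmetric] using one_minus_power_nonzero[OF q, of n] by (rule nonzero_mult_div_cancel_right[symmetric])
  have c1: "convergent_prod (\<lambda>n. ?g (Suc n))"
    unfolding g_eq using one_minus_power_nonzero[OF q]
    by (intro convergent_prod_divide convergent_prod_E q qa)
  have G: "(\<Prod>n. ?g (Suc n)) * E q = E (q ^ a)"
    unfolding E_def by (subst prodinf_mult[OF c1 convergent_prod_E[OF q]]) (simp only: g)
  have c0: "convergent_prod ?g"
    using c1 convergent_prod_Suc_iff[of ?g] by blast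
  have "?g 0 = of_nat a" by (simp add: geom_quot_eq_sum)
  then have "prodinf ?g = of_nat a * (\<Prod>n. ?g (Suc n))"
    using prodinf_split_head[OF c0] a by simp
  moreover have "(\<Prod>n. prod_factor a q 1 (Suc n)) = prodinf ?g * (\<Prod>n. ?g (Suc n))"
    unfolding prodinf_mult[OF c0 c1] by (simp add: prod_factor_def)
  ultimately show ?thesis
    unfolding G[symmetric] by (simp add: power2_eq_square mult_ac)
qed

lemma crank_sum_at_one: "crank_sum a q 1 = of_nat a * (\<Sum>\<^sub>\<infinity>n\<in>zero_sum_vecs a. q powi weight a n)"
  unfolding crank_sum_def by (simp add: infsum_cmult_left')

section \<open>The product formula\<close>

lemma crank_sum_eq_product:
  fixes q z :: complex
  assumes a: "a \<ge> 2" and q: "q \<noteq> 0" "norm q < 1" and z: "z \<noteq> 0"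
  shows "crank_sum a q z = E q * E (q ^ a) ^ (a - 2) * (\<Prod>n. prod_factor a q z (Suc n))"
proof -
  have a0: "a > 0" using a by simp
  have qa: "norm (q ^ a) < 1"
    using a0 q by (auto simp: norm_power power_less_one_iff)
  let ?P = "\<lambda>z. \<Prod>n. prod_factor a q z (Suc n)"
  obtain D0 where D0: "\<And>z. z \<noteq> 0 \<Longrightarrow> crank_sum a q z * theta q (- z) = D0 * theta (q ^ a) (- (z ^ a))"
    using crank_sum_times_theta[OF a0 q] by blast
  define D where "D = D0 * E (q ^ a) / E q"
  have D: "crank_sum a q z = D * ?P z" if "z \<noteq> 0" for z
  proof (rule eq_on_sphere_of_theta_nonzero[OF q that])
    show "continuous_on (sphere 0 (norm z)) (crank_sum a q)"
      "continuous_on (sphere 0 (norm z)) (\<lambda>z. D * ?P z)"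
      using that by (auto intro!: continuous_on_crank_sum continuous_intros continuous_on_prod_factor_prodinf a0 q)
    fix w assume w: "norm w = norm z" "theta q (- w) \<noteq> 0"
    then have w0: "w \<noteq> 0" using that by auto
    have "crank_sum a q w * theta q (- w) = D * ?P w * theta q (- w)"
      using D0[OF w0] prod_factor_times_theta[OF a0 q w0] E_nonzero[OF q(2)] by (simp add: D_def field_simps)
    then show "crank_sum a q w = D * ?P w" using w(2) by simp
  qed
  \<comment> \<open>Evaluate \<open>D\<close> at \<open>z = 1\<close>, where both sides are known.\<close>
  have "D * (of_nat a * E (q ^ a) ^ 2) = D * ?P 1 * E q ^ 2"
    using prod_factor_at_one[OF a0 q(2)] by simp
  also have "D * ?P 1 = of_nat a * (E (q ^ a) ^ a / E q)"
    using D[of 1] crank_sum_at_one[of a q] core_generating_function[OF a0 q] by simp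
  finally have D1: "D * E (q ^ a) ^ 2 = E (q ^ a) ^ a * E q"
    using a0 E_nonzero[OF q(2)] by (simp add: field_simps power2_eq_square)
  have a2: "E (q ^ a) ^ a = E (q ^ a) ^ (a - 2) * E (q ^ a) ^ 2"
    unfolding power_add[symmetric] le_add_diff_inverse2[OF a] ..
  have "D * E (q ^ a) ^ 2 = E q * E (q ^ a) ^ (a - 2) * E (q ^ a) ^ 2"
    unfolding D1 a2 by (simp only: mult_ac)
  moreover have "E (q ^ a) ^ 2 \<noteq> 0"
    using E_nonzero[OF qa] by simp
  ultimately have "D = E q * E (q ^ a) ^ (a - 2)"
    by (simp only: mult_cancel_right simp_thms)
  then show ?thesis using D[OF z] by simp
qed

theorem theorem1p2:
  fixes a :: nat and \<tau> q z :: complex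
  assumes "a \<ge> 2"
    and "Im \<tau> > 0"
    and "q = exp (2 * of_real pi * \<i> * \<tau>)"
    and "z \<noteq> 0"
  shows "summand a q z summable_on zero_sum_vecs a \<and>
    convergent_prod (\<lambda>n. prod_factor a q z (Suc n)) \<and>
    (\<Sum>\<^sub>\<infinity>n\<in>zero_sum_vecs a. summand a q z n)
      = E q * E (q ^ a) ^ (a - 2) * (\<Prod>n. prod_factor a q z (Suc n))"
proof -
  have a: "a > 0" using assms(1) by simp
  have q: "q \<noteq> 0" "norm q < 1"
    using assms(2,3) by (simp_all add: mult_pos_pos)
  have S: "(summand a q z has_sum crank_sum a q z) (zero_sum_vecs a)"
    by (rule summand_has_sum[OF a q assms(4)])
  show ?thesis
    using has_sum_imp_summable[OF S] infsumI[OF S] convergent_prod_factor[OF a q(2) assms(4)]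
      crank_sum_eq_product[OF assms(1) q assms(4)] by simp
qed

end
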